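(* Let $\lambda\in\mathbb{C}$ with $|\lambda|<1$, let $d\ge1$, and let $R(z)\in\mathbb{C}(z)^{m\times m}$ be a para-Hermitian rational matrix of the form $$R(z)=R_\lambda(z)+R_0+R_\lambda^*(1/z),\qquad R_\lambda(z)=\sum_{j=1}^d\frac{R_j}{(z-\lambda)^j},\qquad R_0^*=R_0,$$ with constant matrices $R_0,R_1,\dots,R_d\in\mathbb{C}^{m\times m}$ and with $R_d$ invertible. Let $$K_\lambda(z):=\begin{bmatrix}(\lambda-z)I_m&&&\\ I_m&(\lambda-z)I_m&&\\ &\ddots&\ddots&\\ &&I_m&(\lambda-z)I_m\end{bmatrix}\in\mathbb{C}[z]^{dm\times dm},\qquad F:=\begin{bmatrix}R_d\\ R_{d-1}\\ \vdots\\ R_1\end{bmatrix}.$$ Then the pencil $$L_\lambda(z):=\left[\begin{array}{cc|c}0&K_\lambda(z)&F\\ \mathrm{rev}_1K_\lambda^*(z)&0&(1+z)(e_d\otimes I_m)\\ \hline zF^*&(1+z)(e_d^T\otimes I_m)&(1+z)R_0\end{array}\right],$$ where $e_d$ is the last canonical vector of $\mathbb{C}^d$ and $\otimes$ is the Kronecker product, is a strongly minimal $*$-palindromic linearization of $(1+z)R(z)$.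
   Context: For a rational matrix $R(t)$ with complex coefficients, $R^*(t):=[R(\overline{t})]^*$ (the coefficients are conjugate-transposed, the variable is not conjugated). A square rational matrix $R(z)$ is para-Hermitian if $R^*(z)=R(1/z)$. For constant matrices $^*$ is the conjugate transpose. A pencil is a polynomial matrix of the form $L(z)=zL_1+L_0$. For a rational matrix $H(z)$, $\mathrm{rev}_1 H(z):=zH(1/z)$; a square pencil $L(z)$ is $*$-palindromic if $\mathrm{rev}_1L^*(z)=L(z)$. A linear system matrix is a block-partitioned complex pencil $$L(z)=\begin{bmatrix}-A(z)&B(z)\\ C(z)&D(z)\end{bmatrix}=\begin{bmatrix}-zA_1+A_0& zB_1-B_0\\ zC_1-C_0& zD_1-D_0\end{bmatrix}$$ with $A(z)$ a square regular pencil ($\det A(z)\not\equiv0$). Its transfer function is $D(z)+C(z)A(z)^{-1}B(z)$. It is minimal if $\begin{bmatrix}-A(z_0)&B(z_0)\end{bmatrix}$ has full row rank and $\begin{bmatrix}-A(z_0)\\ C(z_0)\end{bmatrix}$ has full column rank for all $z_0\in\mathbb{C}$; minimal at $\infty$ if $\begin{bmatrix}-A_1&B_1\end{bmatrix}$ has full row rank and $\begin{bmatrix}-A_1\\ C_1\end{bmatrix}$ has full column rank; strongly minimal if both hold. A strongly minimal linearization of $H(z)$ is a strongly minimal linear system matrix with transfer function $H(z)$. In the pencil of the claim the partition lines indicate the blocks: the top-left block is $-A(z)$. *)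

theory Defs
  imports
    "HOL-Computational_Algebra.Computational_Algebra"
    "HOL-Computational_Algebra.Field_as_Ring"
    "Jordan_Normal_Form.DL_Rank"
    "Jordan_Normal_Form.Gauss_Jordan_Elimination"
    "Jordan_Normal_Form.Schur_Decomposition"
begin

section \<open>Rational functions and rational matrices\<close>

type_synonym ratfun = "complex poly fract"
type_synonym ratmat = "ratfun mat"

abbreviation zvar :: ratfun where
  "zvar \<equiv> to_fract [:0, 1:]"

abbreviation const_rf :: "complex \<Rightarrow> ratfun" where
  "const_rf c \<equiv> to_fract [:c:]"

abbreviation const_rm :: "complex mat \<Rightarrow> ratmat" where
  "const_rm M \<equiv> map_mat const_rf M"

abbreviation poly_rm :: "complex poly mat \<Rightarrow> ratmat" where
  "poly_rm P \<equiv> map_mat to_fract P"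

text \<open>\<open>cnj_rf f\<close> conjugates the coefficients of \<open>f\<close> but not the variable,
  i.e. it is the rational function \<open>z \<mapsto> cnj (f (cnj z))\<close>;
  \<open>recip_rf f\<close> is the rational function \<open>f (1/z)\<close>.
  See \<open>cnj_rf_Fract\<close> and \<open>recip_rf_Fract\<close> for arbitrary, not necessarily reduced, fractions.\<close>

definition cnj_rf :: "ratfun \<Rightarrow> ratfun" where
  "cnj_rf f = (case quot_of_fract f of (p, q) \<Rightarrow>
     to_fract (map_poly cnj p) / to_fract (map_poly cnj q))"

definition recip_rf :: "ratfun \<Rightarrow> ratfun" where
  "recip_rf f = (case quot_of_fract f of (p, q) \<Rightarrow>
     poly (map_poly const_rf p) (1 / zvar) / poly (map_poly const_rf q) (1 / zvar))"

definition rm_star :: "ratmat \<Rightarrow> ratmat" where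
  "rm_star M = transpose_mat (map_mat cnj_rf M)"

definition rm_recip :: "ratmat \<Rightarrow> ratmat" where
  "rm_recip M = map_mat recip_rf M"

definition para_Hermitian :: "ratmat \<Rightarrow> bool" where
  "para_Hermitian M \<longleftrightarrow> square_mat M \<and> rm_star M = rm_recip M"

definition rev1 :: "ratmat \<Rightarrow> ratmat" where
  "rev1 M = zvar \<cdot>\<^sub>m rm_recip M"

section \<open>Pencils and linear system matrices\<close>

definition pencil :: "complex poly mat \<Rightarrow> bool" where
  "pencil P \<longleftrightarrow> (\<forall>i < dim_row P. \<forall>j < dim_col P. degree (P $$ (i, j)) \<le> 1)"

definition star_palindromic :: "ratmat \<Rightarrow> bool" where
  "star_palindromic M \<longleftrightarrow>
     square_mat M \<and> (\<exists>P. pencil P \<and> M = poly_rm P) \<and> rev1 (rm_star M) = M"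

definition append_cols :: "'a :: zero mat \<Rightarrow> 'a mat \<Rightarrow> 'a mat" (infixr \<open>@\<^sub>c\<close> 65) where
  "A @\<^sub>c B = four_block_mat A B (0\<^sub>m 0 (dim_col A)) (0\<^sub>m 0 (dim_col B))"

definition full_row_rank :: "complex mat \<Rightarrow> bool" where
  "full_row_rank M \<longleftrightarrow> vec_space.rank (dim_row M) M = dim_row M"

definition full_col_rank :: "complex mat \<Rightarrow> bool" where
  "full_col_rank M \<longleftrightarrow> vec_space.rank (dim_row M) M = dim_col M"

definition eval_pm :: "complex poly mat \<Rightarrow> complex \<Rightarrow> complex mat" where
  "eval_pm P z0 = map_mat (\<lambda>p. poly p z0) P"

definition lead_pm :: "complex poly mat \<Rightarrow> complex mat" where
  "lead_pm P = map_mat (\<lambda>p. coeff p 1) P"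

text \<open>The linear system matrix with blocks \<open>-A, B, C, D\<close>; its partition is part of the data.\<close>

definition system_matrix ::
  "complex poly mat \<Rightarrow> complex poly mat \<Rightarrow> complex poly mat \<Rightarrow> complex poly mat \<Rightarrow> complex poly mat"
where
  "system_matrix A B C D = four_block_mat (- A) B C D"

definition is_linear_system ::
  "complex poly mat \<Rightarrow> complex poly mat \<Rightarrow> complex poly mat \<Rightarrow> complex poly mat \<Rightarrow> bool"
where
  "is_linear_system A B C D \<longleftrightarrow>
     square_mat A \<and> dim_row B = dim_row A \<and> dim_col C = dim_col A \<and>
     dim_row D = dim_row C \<and> dim_col D = dim_col B \<and>
     pencil A \<and> pencil B \<and> pencil C \<and> pencil D \<and> det A \<noteq> 0"

definition transfer_function ::
  "complex poly mat \<Rightarrow> complex poly mat \<Rightarrow> complex poly mat \<Rightarrow> complex poly mat \<Rightarrow> ratmat"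
where
  "transfer_function A B C D =
     poly_rm D + poly_rm C * the (mat_inverse (poly_rm A)) * poly_rm B"

definition minimal_system :: "complex poly mat \<Rightarrow> complex poly mat \<Rightarrow> complex poly mat \<Rightarrow> bool" where
  "minimal_system A B C \<longleftrightarrow>
     (\<forall>z0. full_row_rank (- eval_pm A z0 @\<^sub>c eval_pm B z0) \<and>
           full_col_rank (- eval_pm A z0 @\<^sub>r eval_pm C z0))"

definition minimal_at_infinity :: "complex poly mat \<Rightarrow> complex poly mat \<Rightarrow> complex poly mat \<Rightarrow> bool" where
  "minimal_at_infinity A B C \<longleftrightarrow>
     full_row_rank (- lead_pm A @\<^sub>c lead_pm B) \<and> full_col_rank (- lead_pm A @\<^sub>r lead_pm C)"

text \<open>The number \<open>n\<close> is the size of the top-left block \<open>-A\<close> in the partition of \<open>L\<close>.\<close>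

definition strongly_minimal_linearization :: "nat \<Rightarrow> ratmat \<Rightarrow> ratmat \<Rightarrow> bool" where
  "strongly_minimal_linearization n L H \<longleftrightarrow>
     (\<exists>A B C D. is_linear_system A B C D \<and> dim_row A = n \<and>
        L = poly_rm (system_matrix A B C D) \<and>
        minimal_system A B C \<and> minimal_at_infinity A B C \<and>
        transfer_function A B C D = H)"

section \<open>The pencil \<open>L\<^sub>\<lambda>\<close>\<close>

text \<open>\<open>block_mat p q m M\<close> is the \<open>p \<times> q\<close> block matrix whose \<open>(i, j)\<close> block
  is the \<open>m \<times> m\<close> matrix \<open>M i j\<close>, with block indices starting from 0.\<close>

definition block_mat :: "nat \<Rightarrow> nat \<Rightarrow> nat \<Rightarrow> (nat \<Rightarrow> nat \<Rightarrow> 'a mat) \<Rightarrow> 'a mat" where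
  "block_mat p q m M =
     mat (p * m) (q * m) (\<lambda>(i, j). M (i div m) (j div m) $$ (i mod m, j mod m))"

definition kronecker :: "'a :: times mat \<Rightarrow> 'a mat \<Rightarrow> 'a mat" where
  "kronecker A B =
     mat (dim_row A * dim_row B) (dim_col A * dim_col B)
       (\<lambda>(i, j). A $$ (i div dim_row B, j div dim_col B) * B $$ (i mod dim_row B, j mod dim_col B))"

definition K_lam :: "nat \<Rightarrow> nat \<Rightarrow> complex \<Rightarrow> complex poly mat" where
  "K_lam d m lam = block_mat d d m (\<lambda>i j.
     if i = j then [:lam, -1:] \<cdot>\<^sub>m 1\<^sub>m m else if i = j + 1 then 1\<^sub>m m else 0\<^sub>m m m)"

definition F_mat :: "nat \<Rightarrow> nat \<Rightarrow> (nat \<Rightarrow> complex mat) \<Rightarrow> complex mat" where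
  "F_mat d m Rs = block_mat d 1 m (\<lambda>i _. Rs (d - i))"

definition e_last :: "nat \<Rightarrow> complex mat" where
  "e_last d = mat_of_cols d [unit_vec d (d - 1)]"

definition L_lam :: "nat \<Rightarrow> nat \<Rightarrow> complex \<Rightarrow> (nat \<Rightarrow> complex mat) \<Rightarrow> ratmat" where
  "L_lam d m lam Rs =
     (let K = poly_rm (K_lam d m lam); F = F_mat d m Rs; Z = 0\<^sub>m (d * m) (d * m) in
      four_block_mat
        (four_block_mat Z K (rev1 (rm_star K)) Z)
        (const_rm F @\<^sub>r ((1 + zvar) \<cdot>\<^sub>m const_rm (kronecker (e_last d) (1\<^sub>m m))))
        ((zvar \<cdot>\<^sub>m const_rm (mat_adjoint F)) @\<^sub>c
          ((1 + zvar) \<cdot>\<^sub>m const_rm (kronecker (transpose_mat (e_last d)) (1\<^sub>m m))))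
        ((1 + zvar) \<cdot>\<^sub>m const_rm (Rs 0)))"

definition R_lam :: "nat \<Rightarrow> nat \<Rightarrow> complex \<Rightarrow> (nat \<Rightarrow> complex mat) \<Rightarrow> ratmat" where
  "R_lam d m lam Rs =
     mat m m (\<lambda>(i, k). \<Sum>j = 1..d. const_rf (Rs j $$ (i, k)) / (zvar - const_rf lam) ^ j)"

section \<open>Well-definedness of the operations on rational functions\<close>

lemma quot_of_fract_Fract_cross:
  fixes p q :: "complex poly"
  assumes "q \<noteq> 0"
  shows "fst (quot_of_fract (Fract p q)) * q = p * snd (quot_of_fract (Fract p q))"
proof -
  let ?f = "Fract p q"
  have "Fract (fst (quot_of_fract ?f)) (snd (quot_of_fract ?f)) = Fract p q"
    by (rule Fract_quot_of_fract)
  then show ?thesis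
    using assms by (simp add: eq_fract del: Fract_quot_of_fract)
qed

lemma map_poly_cnj_mult: "map_poly cnj (p * q) = map_poly cnj p * map_poly cnj q"
  by (rule poly_eqI) (simp add: coeff_map_poly coeff_mult)

lemma const_rf_add: "const_rf (a + b) = const_rf a + const_rf b"
proof -
  have "[:a + b:] = [:a:] + [:b:]"
    by simp
  then show ?thesis
    by (metis to_fract_add)
qed

lemma const_rf_mult: "const_rf (a * b) = const_rf a * const_rf b"
proof -
  have "[:a * b:] = [:a:] * [:b:]"
    by simp
  then show ?thesis
    by (metis to_fract_mult)
qed

lemma const_rf_sum: "const_rf (sum g S) = (\<Sum>i\<in>S. const_rf (g i))"
  by (induction S rule: infinite_finite_induct) (simp_all add: const_rf_add)

lemma map_poly_const_rf_mult:
  "map_poly const_rf (p * q) = map_poly const_rf p * map_poly const_rf q"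
  by (rule poly_eqI) (simp add: coeff_map_poly coeff_mult const_rf_sum const_rf_mult)

lemma poly_const_rf_zvar: "poly (map_poly const_rf p) zvar = to_fract p"
proof (induction p)
  case (pCons a p)
  have "pCons a p = [:a:] + [:0, 1:] * p"
    by simp
  then have "to_fract (pCons a p) = const_rf a + zvar * to_fract p"
    by (metis to_fract_add to_fract_mult)
  with pCons show ?case
    by (simp add: map_poly_pCons)
qed simp

lemma poly_const_rf_recip_nonzero:
  assumes "q \<noteq> 0"
  shows "poly (map_poly const_rf q) (1 / zvar) \<noteq> 0"
proof -
  let ?Q = "map_poly const_rf q"
  have "reflect_poly ?Q = map_poly const_rf (reflect_poly q)"
    by (rule poly_eqI) (simp add: coeff_reflect_poly coeff_map_poly degree_map_poly)
  then have "poly (reflect_poly ?Q) zvar \<noteq> 0"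
    using assms by (simp add: poly_const_rf_zvar)
  moreover have "poly (reflect_poly ?Q) zvar = zvar ^ degree ?Q * poly ?Q (inverse zvar)"
    by (rule poly_reflect_poly_nz) simp
  ultimately show ?thesis
    by (auto simp: inverse_eq_divide)
qed

lemma cnj_rf_Fract:
  assumes "q \<noteq> 0"
  shows "cnj_rf (Fract p q) = Fract (map_poly cnj p) (map_poly cnj q)"
proof -
  obtain a b where ab: "quot_of_fract (Fract p q) = (a, b)"
    by force
  have b: "b \<noteq> 0"
    using snd_quot_of_fract_nonzero[of "Fract p q"] ab by simp
  have nz: "map_poly cnj r \<noteq> 0" if "r \<noteq> 0" for r
    using that by (simp add: map_poly_eq_0_iff)
  have "map_poly cnj a * map_poly cnj q = map_poly cnj p * map_poly cnj b"
    using quot_of_fract_Fract_cross[OF assms, of p] ab by (simp flip: map_poly_cnj_mult)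
  then show ?thesis
    using ab b assms nz by (simp add: cnj_rf_def to_fract_def eq_fract)
qed

lemma recip_rf_Fract:
  assumes "q \<noteq> 0"
  shows "recip_rf (Fract p q) =
    poly (map_poly const_rf p) (1 / zvar) / poly (map_poly const_rf q) (1 / zvar)"
proof -
  let ?e = "\<lambda>r. poly (map_poly const_rf r) (1 / zvar)"
  obtain a b where ab: "quot_of_fract (Fract p q) = (a, b)"
    by force
  have b: "b \<noteq> 0"
    using snd_quot_of_fract_nonzero[of "Fract p q"] ab by simp
  have "?e a * ?e q = ?e p * ?e b"
    using quot_of_fract_Fract_cross[OF assms, of p] ab
    by (simp flip: map_poly_const_rf_mult poly_mult)
  then show ?thesis
    using ab poly_const_rf_recip_nonzero[OF b] poly_const_rf_recip_nonzero[OF assms]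
    by (simp add: recip_rf_def frac_eq_eq)
qed

end

theory Submission
  imports Defs
begin

text \<open>Both minimality conditions say that certain matrices, obtained by evaluating the pencil at a
  point \<open>(s : t)\<close> of the projective line, have trivial kernel; the point at infinity is \<open>(0 : 1)\<close>.
  Since \<open>cmod lam < 1\<close>, at most one of \<open>K\<close> and \<open>rev\<^sub>1 K\<^sup>*\<close> is singular there, at \<open>lam\<close> or at
  \<open>1 / cnj lam\<close>, and \<open>s + t \<noteq> 0\<close> at these two points. A kernel vector of the singular factor is
  supported on its first or last block, where it is killed by the invertible matrix \<open>R\<^sub>d\<close> or by
  \<open>(1 + z) e\<^sub>d\<close>. For the transfer function, the block bidiagonal systems \<open>A Y = B\<close> are solved
  by forward and backward substitution.\<close>

section \<open>Rank criteria\<close>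

text \<open>The factor \<open>1 + z\<close> turns a para-Hermitian matrix into a palindromic one:
  reversing the star of \<open>(1 + z) R(z)\<close> gives
  \<open>z (1 + 1/z) R^*(1/z) = (1 + z) R(z)\<close>. Its root \<open>-1\<close> lies on the unit
  circle, while \<open>lam\<close> and \<open>1 / cnj lam\<close> do not; hence \<open>s + t\<close>
  is nonzero at both singular points. For \<open>lam = 0\<close> the second point is infinity, and
  the coordinates \<open>(s : t)\<close> with \<open>z = t / s\<close> cover this case without a
  division by \<open>lam\<close>. Transposing an antidiagonal block matrix transposes its two
  factors and exchanges their places. The row and the column condition therefore have the same
  shape, with the roles of the factors swapped, and one kernel lemma serves both. Blocks are
  flattened: neighbouring blocks are entries at distance \<open>m\<close>, so substitution along
  blocks becomes induction over entries.\<close>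

lemma conjugate_mat_adjoint_mult_vec:
  fixes M :: "complex mat"
  assumes M: "M \<in> carrier_mat n nc" and x: "x \<in> carrier_vec n"
  shows "conjugate (mat_adjoint M *\<^sub>v x) = M\<^sup>T *\<^sub>v conjugate x"
  using assms
  by (intro eq_vecI)
    (auto simp: mat_adjoint_def scalar_prod_def conjugate_vec_def sum_conjugate conjugate_dist_mul
      intro!: sum.cong)

text \<open>Injectivity of the transpose passes to the Gram matrix \<open>M M^*\<close>: if
  \<open>M M^* x = 0\<close>, then \<open>M^* x\<close> has norm zero, and conjugation brings back
  the transpose. A right inverse \<open>B\<close> of the Gram matrix makes \<open>M^* B\<close> a
  right inverse of \<open>M\<close>, so the columns span the whole space. Stating the hypothesis for
  the transpose keeps conjugation out of its applications.\<close>

lemma full_row_rankI: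
  assumes inj: "\<And>v. v \<in> carrier_vec (dim_row M) \<Longrightarrow> M\<^sup>T *\<^sub>v v = 0\<^sub>v (dim_col M) \<Longrightarrow> v = 0\<^sub>v (dim_row M)"
  shows "full_row_rank M"
proof -
  define n where "n = dim_row M"
  define nc where "nc = dim_col M"
  have M: "M \<in> carrier_mat n nc" by (simp add: n_def nc_def)
  interpret vec_space "TYPE(complex)" n .
  have adj: "mat_adjoint M \<in> carrier_mat nc n"
    using M by (auto simp: mat_adjoint_def)
  define N where "N = M * mat_adjoint M"
  have N: "N \<in> carrier_mat n n"
    using M adj by (simp add: N_def)
  have "det N \<noteq> 0"
  proof
    assume "det N = 0"
    then obtain x where x: "x \<in> carrier_vec n" "x \<noteq> 0\<^sub>v n" "N *\<^sub>v x = 0\<^sub>v n"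
      using det_0_iff_vec_prod_zero_field[OF N] by blast
    define w where "w = mat_adjoint M *\<^sub>v x"
    have w: "w \<in> carrier_vec nc"
      using adj x by (simp add: w_def)
    have "M *\<^sub>v w = 0\<^sub>v n"
      using x M adj by (simp add: w_def N_def)
    moreover have cw: "conjugate w = M\<^sup>T *\<^sub>v conjugate x"
      using conjugate_mat_adjoint_mult_vec[OF M x(1)] by (simp add: w_def)
    moreover have "(M\<^sup>T *\<^sub>v conjugate x) \<bullet> w = conjugate x \<bullet> (M *\<^sub>v w)"
      using transpose_vec_mult_scalar[OF M w, of "conjugate x"] x by simp
    ultimately have "conjugate w \<bullet> w = 0"
      using x by simp
    then have "w \<bullet>c w = 0"
      using w by (metis carrier_vec_conjugate comm_scalar_prod)
    then have "w = 0\<^sub>v nc"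
      using conjugate_square_eq_0_vec[OF w] by blast
    then have "M\<^sup>T *\<^sub>v conjugate x = 0\<^sub>v nc"
      using cw[symmetric] by auto
    then have "conjugate x = 0\<^sub>v n"
      using inj[of "conjugate x"] x by (simp add: n_def nc_def)
    then have "conjugate (conjugate x) = 0\<^sub>v n"
      by (auto simp: conjugate_vec_def)
    then have "x = 0\<^sub>v n" by simp
    then show False using x by blast
  qed
  then obtain B where B: "B \<in> carrier_mat n n" "N * B = 1\<^sub>m n"
    using det_non_zero_imp_unit[OF N, of "()"] by (auto simp: Units_def ring_mat_def)
  have "M *\<^sub>v (mat_adjoint M *\<^sub>v (B *\<^sub>v y)) = y" if "y \<in> carrier_vec n" for y
  proof -
    have "M *\<^sub>v (mat_adjoint M *\<^sub>v (B *\<^sub>v y)) = N *\<^sub>v (B *\<^sub>v y)"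
      using M adj B that by (simp add: N_def)
    also have "\<dots> = y"
      using N B that by (simp flip: assoc_mult_mat_vec)
    finally show ?thesis .
  qed
  moreover have "mat_adjoint M *\<^sub>v (B *\<^sub>v y) \<in> carrier_vec nc" if "y \<in> carrier_vec n" for y
    using adj B that by simp
  ultimately have "carrier_vec n \<subseteq> col_space M"
    using M unfolding col_space_eq[OF M] by blast
  moreover have "col_space M \<subseteq> carrier_vec n"
    using M unfolding col_space_eq[OF M] by blast
  ultimately have "col_space M = carrier_vec n"
    by blast
  then have "span (set (cols M)) = carrier_vec n"
    by (simp add: col_space_def)
  then have "rank M = n"
    using dim_is_n by (simp add: rank_def module_vec_def)
  then show ?thesis
    by (simp add: full_row_rank_def n_def)
qed

lemma full_col_rankI:
  assumes inj: "\<And>v. v \<in> carrier_vec (dim_col M) \<Longrightarrow> M *\<^sub>v v = 0\<^sub>v (dim_row M) \<Longrightarrow> v = 0\<^sub>v (dim_col M)"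
  shows "full_col_rank M"
proof -
  define n where "n = dim_row M"
  define nc where "nc = dim_col M"
  have M: "M \<in> carrier_mat n nc" by (simp add: n_def nc_def)
  interpret vec_space "TYPE(complex)" n .
  \<comment> \<open>The rank is computed from the set of columns, so repetitions must be excluded:
    equal columns \<open>i\<close> and \<open>j\<close> would put the difference of two unit vectors
    into the kernel.\<close>
  have dist: "distinct (cols M)"
  proof (rule ccontr)
    assume "\<not> distinct (cols M)"
    then obtain i j where ij: "i < length (cols M)" "j < length (cols M)" "i \<noteq> j" "cols M ! i = cols M ! j"
      using distinct_conv_nth by blast
    then have i: "i < nc" and j: "j < nc" and eq: "col M i = col M j"
      by (simp_all add: nc_def)
    have "M *\<^sub>v (unit_vec nc i - unit_vec nc j) = M *\<^sub>v unit_vec nc i - M *\<^sub>v unit_vec nc j"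
      using M by (simp add: mult_minus_distrib_mat_vec)
    moreover have "M *\<^sub>v unit_vec nc k = col M k" if "k < nc" for k
      using M that by (intro eq_vecI) simp_all
    then have "M *\<^sub>v unit_vec nc i - M *\<^sub>v unit_vec nc j = 0\<^sub>v n"
      using M i j eq by simp
    ultimately have "M *\<^sub>v (unit_vec nc i - unit_vec nc j) = 0\<^sub>v n"
      by simp
    then have "unit_vec nc i - unit_vec nc j = (0\<^sub>v nc :: complex vec)"
      unfolding n_def nc_def by (intro inj) simp_all
    then have "(unit_vec nc i - unit_vec nc j) $ i = (0 :: complex)"
      using i by simp
    then have False using i j ij(3) by simp
    then show False .
  qed
  have "lin_indpt (set (cols M))"
  proof
    assume "lin_dep (set (cols M))"
    then obtain v where "v \<in> carrier_vec nc" "v \<noteq> 0\<^sub>v nc" "M *\<^sub>v v = 0\<^sub>v n"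
      using lin_depE[OF M _ dist] by blast
    then show False
      using inj by (simp add: n_def nc_def)
  qed
  then have "rank M = nc"
    by (rule lin_indpt_full_rank[OF M dist])
  then show ?thesis
    by (simp add: full_col_rank_def n_def nc_def)
qed

lemma append_vec_zero [simp]: "0\<^sub>v a @\<^sub>v 0\<^sub>v b = 0\<^sub>v (a + b)"
  by (intro eq_vecI) auto

lemma append_vec_eq_zero_iff:
  assumes "v \<in> carrier_vec a" "w \<in> carrier_vec b"
  shows "v @\<^sub>v w = 0\<^sub>v (a + b) \<longleftrightarrow> v = 0\<^sub>v a \<and> w = 0\<^sub>v b"
  using append_vec_eq[OF assms(1) zero_carrier_vec, of w "0\<^sub>v b"] by simp

lemma full_row_rank_append_colsI:
  assumes X: "X \<in> carrier_mat n a" and Y: "Y \<in> carrier_mat n b"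
    and inj: "\<And>v. v \<in> carrier_vec n \<Longrightarrow> X\<^sup>T *\<^sub>v v = 0\<^sub>v a \<Longrightarrow> Y\<^sup>T *\<^sub>v v = 0\<^sub>v b \<Longrightarrow> v = 0\<^sub>v n"
  shows "full_row_rank (X @\<^sub>c Y)"
proof (rule full_row_rankI)
  have T: "(X @\<^sub>c Y)\<^sup>T = X\<^sup>T @\<^sub>r Y\<^sup>T"
    unfolding append_cols_def append_rows_def
    using X Y by (subst transpose_four_block_mat[of _ n a _ b _ 0]) auto
  fix v :: "complex vec"
  assume v: "v \<in> carrier_vec (dim_row (X @\<^sub>c Y))"
    and 0: "(X @\<^sub>c Y)\<^sup>T *\<^sub>v v = 0\<^sub>v (dim_col (X @\<^sub>c Y))"
  have v': "v \<in> carrier_vec n"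
    using v X by (simp add: append_cols_def)
  have "(X\<^sup>T *\<^sub>v v) @\<^sub>v (Y\<^sup>T *\<^sub>v v) = 0\<^sub>v (a + b)"
    using 0 X Y v' mat_mult_append[of "X\<^sup>T" a n "Y\<^sup>T" b v] unfolding T
    by (simp add: append_cols_def)
  then have "X\<^sup>T *\<^sub>v v = 0\<^sub>v a \<and> Y\<^sup>T *\<^sub>v v = 0\<^sub>v b"
    using X Y v' by (subst (asm) append_vec_eq_zero_iff) auto
  then show "v = 0\<^sub>v (dim_row (X @\<^sub>c Y))"
    using inj v' X by (auto simp: append_cols_def)
qed

lemma full_col_rank_append_rowsI:
  assumes X: "X \<in> carrier_mat a n" and Y: "Y \<in> carrier_mat b n"
    and inj: "\<And>v. v \<in> carrier_vec n \<Longrightarrow> X *\<^sub>v v = 0\<^sub>v a \<Longrightarrow> Y *\<^sub>v v = 0\<^sub>v b \<Longrightarrow> v = 0\<^sub>v n"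
  shows "full_col_rank (X @\<^sub>r Y)"
proof (rule full_col_rankI)
  fix v :: "complex vec"
  assume v: "v \<in> carrier_vec (dim_col (X @\<^sub>r Y))"
    and 0: "(X @\<^sub>r Y) *\<^sub>v v = 0\<^sub>v (dim_row (X @\<^sub>r Y))"
  have v': "v \<in> carrier_vec n"
    using v X by (simp add: append_rows_def)
  have "(X *\<^sub>v v) @\<^sub>v (Y *\<^sub>v v) = 0\<^sub>v (a + b)"
    using 0 X Y v' mat_mult_append[of X a n Y b v]
    by (simp add: append_rows_def)
  then have "X *\<^sub>v v = 0\<^sub>v a \<and> Y *\<^sub>v v = 0\<^sub>v b"
    using X Y v' by (subst (asm) append_vec_eq_zero_iff) auto
  then show "v = 0\<^sub>v (dim_col (X @\<^sub>r Y))"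
    using inj v' X by (auto simp: append_rows_def)
qed

section \<open>Pencils under the reversal of the adjoint\<close>

lemma const_rf_1 [simp]: "const_rf 1 = 1"
  by (metis one_pCons to_fract_1)

lemma map_poly_const_poly: "f 0 = 0 \<Longrightarrow> map_poly f [:a:] = [:f a:]"
  by (rule poly_eqI) (simp add: coeff_map_poly coeff_pCons split: nat.splits)

lemma map_poly_linear: "f 0 = 0 \<Longrightarrow> map_poly f [:a, b:] = [:f a, f b:]"
  by (rule poly_eqI) (simp add: coeff_map_poly coeff_pCons split: nat.splits)

lemma map_poly_one: "f 0 = 0 \<Longrightarrow> f 1 = 1 \<Longrightarrow> map_poly f 1 = 1"
  using map_poly_const_poly[of f 1] by (simp add: one_pCons)

lemma cnj_rf_to_fract: "cnj_rf (to_fract p) = to_fract (map_poly cnj p)"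
  by (simp add: cnj_rf_def)

lemma recip_rf_to_fract: "recip_rf (to_fract p) = poly (map_poly const_rf p) (1 / zvar)"
  by (simp add: recip_rf_def)

lemma map_poly_cnj_add: "map_poly cnj (p + q) = map_poly cnj p + map_poly cnj q"
  by (rule poly_eqI) (simp add: coeff_map_poly)

lemma map_poly_const_rf_add:
  "map_poly const_rf (p + q) = map_poly const_rf p + map_poly const_rf q"
  by (rule poly_eqI) (simp add: coeff_map_poly const_rf_add)

text \<open>The homomorphism laws later carry the operation through the sums, powers and quotients
  in \<open>R_lam\<close>. Their proof needs the formula for unreduced fractions, since adding or
  multiplying reduced fractions crosswise need not give a reduced one.\<close>

interpretation cnj_rf: field_hom cnj_rf
proof
  show "cnj_rf 0 = 0" "cnj_rf 1 = 1"
    using cnj_rf_to_fract[of 0] cnj_rf_to_fract[of 1] by (simp_all add: map_poly_one)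
  fix x y :: ratfun
  obtain a b c d where xy: "x = Fract a b" "b \<noteq> 0" "y = Fract c d" "d \<noteq> 0"
    by (meson Fract_cases)
  have nz: "map_poly cnj r \<noteq> 0" if "r \<noteq> 0" for r
    using that by (simp add: map_poly_eq_0_iff)
  show "cnj_rf (x + y) = cnj_rf x + cnj_rf y"
    using xy nz by (simp add: cnj_rf_Fract map_poly_cnj_mult map_poly_cnj_add)
  show "cnj_rf (x * y) = cnj_rf x * cnj_rf y"
    using xy nz by (simp add: cnj_rf_Fract map_poly_cnj_mult)
qed

interpretation recip_rf: field_hom recip_rf
proof
  show "recip_rf 0 = 0" "recip_rf 1 = 1"
    using recip_rf_to_fract[of 0] recip_rf_to_fract[of 1]
    by (simp_all add: map_poly_one)
  fix x y :: ratfun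
  obtain a b c d where xy: "x = Fract a b" "b \<noteq> 0" "y = Fract c d" "d \<noteq> 0"
    by (meson Fract_cases)
  note nz = poly_const_rf_recip_nonzero
  show "recip_rf (x + y) = recip_rf x + recip_rf y"
    using xy nz[of b] nz[of d]
    by (simp add: recip_rf_Fract map_poly_const_rf_mult map_poly_const_rf_add add_frac_eq)
  show "recip_rf (x * y) = recip_rf x * recip_rf y"
    using xy by (simp add: recip_rf_Fract map_poly_const_rf_mult)
qed

lemma cnj_rf_const [simp]: "cnj_rf (const_rf c) = const_rf (cnj c)"
  by (simp add: cnj_rf_to_fract map_poly_const_poly map_poly_linear)

lemma cnj_rf_zvar [simp]: "cnj_rf zvar = zvar"
  by (simp add: cnj_rf_to_fract map_poly_const_poly map_poly_linear)

lemma recip_rf_const [simp]: "recip_rf (const_rf c) = const_rf c"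
  by (simp add: recip_rf_to_fract map_poly_const_poly map_poly_linear)

lemma recip_rf_zvar [simp]: "recip_rf zvar = 1 / zvar"
  by (simp add: recip_rf_to_fract map_poly_const_poly map_poly_linear)

lemma to_fract_linear: "to_fract [:a, b:] = const_rf a + const_rf b * zvar"
  by (simp flip: to_fract_add to_fract_mult)

text \<open>For \<open>p = a + b z\<close> this is \<open>z p^*(1/z)\<close>, so the reversal of the
  adjoint of a pencil can be computed among polynomials. In higher degree the formula loses this
  meaning, whence the degree hypotheses below.\<close>

definition rev_star_poly :: "complex poly \<Rightarrow> complex poly" where
  "rev_star_poly p = [:cnj (coeff p 1), cnj (coeff p 0):]"

definition rev_star_pencil :: "complex poly mat \<Rightarrow> complex poly mat" where
  "rev_star_pencil P = transpose_mat (map_mat rev_star_poly P)"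

lemma linear_poly_eq: "degree p \<le> 1 \<Longrightarrow> p = [:coeff p 0, coeff p 1:]"
  by (rule poly_eqI) (auto simp: coeff_pCons coeff_eq_0 split: nat.splits)

lemma rev_star_rf:
  assumes "degree p \<le> 1"
  shows "zvar * recip_rf (cnj_rf (to_fract p)) = to_fract (rev_star_poly p)"
proof -
  obtain a b where p: "p = [:a, b:]"
    using linear_poly_eq[OF assms] by blast
  have "rev_star_poly p = [:cnj b, cnj a:]"
    by (simp add: p rev_star_poly_def)
  moreover have "zvar * recip_rf (const_rf (cnj a) + const_rf (cnj b) * zvar)
    = const_rf (cnj b) + const_rf (cnj a) * zvar"
    by (simp add: recip_rf.hom_add recip_rf.hom_mult distrib_left)
  ultimately show ?thesis
    unfolding p to_fract_linear[of a b] 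
    by (simp only: to_fract_linear[of "cnj b" "cnj a"] cnj_rf.hom_add cnj_rf.hom_mult cnj_rf_const cnj_rf_zvar)
qed

lemma rev1_rm_star_poly_rm:
  assumes "pencil P"
  shows "rev1 (rm_star (poly_rm P)) = poly_rm (rev_star_pencil P)"
  using assms
  by (intro eq_matI)
    (auto simp: rev1_def rm_star_def rm_recip_def rev_star_pencil_def pencil_def rev_star_rf)

section \<open>Kernels of block bidiagonal matrices\<close>

text \<open>Flattened block bidiagonal matrix with blocks \<open>a I_m\<close> on the diagonal and
  \<open>b I_m\<close> below it. For \<open>m = 0\<close> the two positions coincide and the first
  branch wins, so the lemmas on products with vectors assume \<open>m > 0\<close>.\<close>

definition shift_mat :: "nat \<Rightarrow> nat \<Rightarrow> 'a \<Rightarrow> 'a \<Rightarrow> 'a :: zero mat" where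
  "shift_mat n m a b = mat n n (\<lambda>(i, j). if i = j then a else if i = j + m then b else 0)"

lemma shift_mat_carrier [simp]: "shift_mat n m a b \<in> carrier_mat n n"
  by (simp add: shift_mat_def)

lemma shift_mat_dim [simp]: "dim_row (shift_mat n m a b) = n" "dim_col (shift_mat n m a b) = n"
  by (simp_all add: shift_mat_def)

lemma index_shift_mat [simp]:
  "i < n \<Longrightarrow> j < n \<Longrightarrow> shift_mat n m a b $$ (i, j) = (if i = j then a else if i = j + m then b else 0)"
  by (simp add: shift_mat_def)

lemma map_shift_mat: "f 0 = 0 \<Longrightarrow> map_mat f (shift_mat n m a b) = shift_mat n m (f a) (f b)"
  by (intro eq_matI) auto

lemma K_lam_eq_shift_mat: "K_lam d m lam = shift_mat (d * m) m [:lam, -1:] 1"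
proof (intro eq_matI)
  fix i j
  assume "i < dim_row (shift_mat (d * m) m [:lam, -1:] (1 :: complex poly))"
    and "j < dim_col (shift_mat (d * m) m [:lam, -1:] (1 :: complex poly))"
  then have ij: "i < d * m" "j < d * m" by simp_all
  then have m: "m > 0" by (cases m) auto
  have "i = j \<longleftrightarrow> i div m = j div m \<and> i mod m = j mod m"
    by (metis div_mult_mod_eq)
  \<comment> \<open>Indices at distance \<open>m\<close> sit in consecutive blocks at the same inner
    position.\<close>
  moreover have "i = j + m \<longleftrightarrow> i div m = j div m + 1 \<and> i mod m = j mod m"
    using m by (metis div_add_self2 div_mult_mod_eq mod_add_self2 not_gr_zero)
  ultimately show "K_lam d m lam $$ (i, j) = shift_mat (d * m) m [:lam, -1:] 1 $$ (i, j)"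
    using ij m by (auto simp: K_lam_def block_mat_def)
qed (simp_all add: K_lam_def block_mat_def)

lemma shift_mat_mult_vec:
  fixes a b :: "'a :: comm_ring_1"
  assumes v: "v \<in> carrier_vec n" and i: "i < n" and m: "m > 0"
  shows "(shift_mat n m a b *\<^sub>v v) $ i = a * v $ i + (if m \<le> i then b * v $ (i - m) else 0)"
proof -
  have "(shift_mat n m a b *\<^sub>v v) $ i
      = (\<Sum>j\<in>{0..<n}. (if i = j then a else if i = j + m then b else 0) * v $ j)"
    using v i by (simp add: scalar_prod_def)
  \<comment> \<open>Subtraction truncates at zero, so \<open>j = i - m\<close> expresses
    \<open>i = j + m\<close> only under the guard \<open>m \<le> i\<close>.\<close>
  also have "\<dots> = (\<Sum>j\<in>{0..<n}. (if j = i then a * v $ j else 0)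
      + (if j = i - m then if m \<le> i then b * v $ j else 0 else 0))"
    using m by (intro sum.cong) auto
  also have "\<dots> = a * v $ i + (if m \<le> i then b * v $ (i - m) else 0)"
    using i less_imp_diff_less[of i n m] by (simp add: sum.distrib)
  finally show ?thesis .
qed

lemma shift_mat_transpose_mult_vec:
  fixes a b :: "'a :: comm_ring_1"
  assumes v: "v \<in> carrier_vec n" and i: "i < n" and m: "m > 0"
  shows "((shift_mat n m a b)\<^sup>T *\<^sub>v v) $ i = a * v $ i + (if i + m < n then b * v $ (i + m) else 0)"
proof -
  have "((shift_mat n m a b)\<^sup>T *\<^sub>v v) $ i
      = (\<Sum>j\<in>{0..<n}. (if j = i then a else if j = i + m then b else 0) * v $ j)"
    using v i by (simp add: scalar_prod_def)
  also have "\<dots> = (\<Sum>j\<in>{0..<n}. (if j = i then a * v $ j else 0)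
      + (if j = i + m then b * v $ j else 0))"
    using m by (intro sum.cong) auto
  also have "\<dots> = a * v $ i + (if i + m < n then b * v $ (i + m) else 0)"
    using i by (simp add: sum.distrib)
  finally show ?thesis .
qed

lemma shift_mat_kernel:
  fixes a b :: "'a :: field"
  assumes v: "v \<in> carrier_vec n" and a: "a \<noteq> 0" and m: "m > 0"
    and 0: "shift_mat n m a b *\<^sub>v v = 0\<^sub>v n"
  shows "v = 0\<^sub>v n"
proof -
  have "v $ i = 0" if "i < n" for i
    using that
  proof (induction i rule: less_induct)
    case (less i)
    have "m \<le> i \<Longrightarrow> v $ (i - m) = 0"
      using less.IH[of "i - m"] less.prems m by simp
    then show ?case
      using shift_mat_mult_vec[OF v less.prems m, of a b] a less.prems by (simp add: 0 split: if_splits)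
  qed
  then show ?thesis
    using v by (intro eq_vecI) auto
qed

lemma shift_mat_transpose_kernel:
  fixes a b :: "'a :: field"
  assumes v: "v \<in> carrier_vec n" and a: "a \<noteq> 0" and m: "m > 0"
    and 0: "(shift_mat n m a b)\<^sup>T *\<^sub>v v = 0\<^sub>v n"
  shows "v = 0\<^sub>v n"
proof -
  have "v $ i = 0" if "i < n" for i
    using that
  \<comment> \<open>The transpose couples \<open>i\<close> with \<open>i + m\<close>, so the
    induction runs upwards from the last entry.\<close>
  proof (induction "n - i" arbitrary: i rule: less_induct)
    case less
    have "i + m < n \<Longrightarrow> v $ (i + m) = 0"
      using less m by simp
    then show ?case
      using shift_mat_transpose_mult_vec[OF v less.prems m, of a b] a less.prems
      by (simp add: 0 split: if_splits)
  qed
  then show ?thesis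
    using v by (intro eq_vecI) auto
qed

text \<open>The matrix \<open>[0 ... 0 I_m]\<close>, which for \<open>n = d * m\<close> and
  \<open>d \<ge> 1\<close> is the Kronecker product of the transposed last unit vector with the
  identity.\<close>

definition last_block :: "nat \<Rightarrow> nat \<Rightarrow> 'a :: zero_neq_one mat" where
  "last_block n m = mat m n (\<lambda>(i, j). if j = n - m + i then 1 else 0)"

lemma last_block_carrier [simp]: "last_block n m \<in> carrier_mat m n"
  by (simp add: last_block_def)

lemma last_block_dim [simp]: "dim_row (last_block n m) = m" "dim_col (last_block n m) = n"
  by (simp_all add: last_block_def)

lemma last_block_mult_vec:
  fixes v :: "'a :: comm_ring_1 vec"
  assumes "v \<in> carrier_vec n" "i < m" "m \<le> n"
  shows "(last_block n m *\<^sub>v v) $ i = v $ (n - m + i)"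
proof -
  have "(last_block n m *\<^sub>v v) $ i = (\<Sum>j\<in>{0..<n}. (if j = n - m + i then 1 else 0) * v $ j)"
    using assms unfolding last_block_def by (simp add: scalar_prod_def)
  also have "\<dots> = (\<Sum>j\<in>{0..<n}. if j = n - m + i then v $ j else 0)"
    by (intro sum.cong) auto
  finally show ?thesis
    using assms by simp
qed

text \<open>Common core of both rank conditions. A singular transposed factor confines
  \<open>u\<close> to the first block, a singular untransposed one confines \<open>v\<close> to the
  last. The implications on \<open>a\<close> and \<open>a'\<close> exclude that both are singular,
  so the single equation \<open>uv\<close> never has to control both vectors at once.
  \<open>mat m m (($$) H)\<close> is the leading block of \<open>H\<close>, later the transpose or
  adjoint of \<open>R_d\<close>.\<close>

lemma block_bidiagonal_kernel:
  fixes a b a' b' f c :: "'a :: field"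
  assumes m: "m \<le> n"
    and u: "u \<in> carrier_vec n" and v: "v \<in> carrier_vec n"
    and H: "H \<in> carrier_mat m n"
    and inj: "\<And>w. w \<in> carrier_vec m \<Longrightarrow> mat m m (($$) H) *\<^sub>v w = 0\<^sub>v m \<Longrightarrow> w = 0\<^sub>v m"
    and Ku: "(shift_mat n m a b)\<^sup>T *\<^sub>v u = 0\<^sub>v n"
    and Kv: "shift_mat n m a' b' *\<^sub>v v = 0\<^sub>v n"
    and uv: "f \<cdot>\<^sub>v (H *\<^sub>v u) + c \<cdot>\<^sub>v (last_block n m *\<^sub>v v) = 0\<^sub>v m"
    and a: "a = 0 \<Longrightarrow> b \<noteq> 0 \<and> f \<noteq> 0 \<and> a' \<noteq> 0"
    and a': "a' = 0 \<Longrightarrow> b' \<noteq> 0 \<and> c \<noteq> 0"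
    and m0: "m > 0"
  shows "u = 0\<^sub>v n \<and> v = 0\<^sub>v n"
proof (cases "a = 0")
  case True
  then have nz: "b \<noteq> 0" "f \<noteq> 0" "a' \<noteq> 0"
    using a by auto
  have v0: "v = 0\<^sub>v n"
    using shift_mat_kernel[OF v nz(3) m0 Kv] .
  \<comment> \<open>For \<open>a = 0\<close> the product only moves \<open>u\<close> up by
    \<open>m\<close> places and scales it by \<open>b\<close>, so coordinate \<open>j - m\<close>
    isolates \<open>u $ j\<close>.\<close>
  have tail: "u $ j = 0" if "m \<le> j" "j < n" for j
  proof -
    have "((shift_mat n m a b)\<^sup>T *\<^sub>v u) $ (j - m) = b * u $ j"
      using shift_mat_transpose_mult_vec[OF u, of "j - m" m a b] that m0 True by simp
    moreover have "((shift_mat n m a b)\<^sup>T *\<^sub>v u) $ (j - m) = 0"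
      using that by (simp add: Ku)
    ultimately show ?thesis
      using nz by simp
  qed
  have "last_block n m *\<^sub>v v = 0\<^sub>v m"
    unfolding v0 by (intro eq_vecI) (auto simp: scalar_prod_def)
  then have Hu: "(H *\<^sub>v u) $ i = 0" if "i < m" for i
    using arg_cong[OF uv, of "\<lambda>x. vec_index x i"] that nz(2) H u by simp
  define w where "w = vec m (($) u)"
  have "mat m m (($$) H) *\<^sub>v w = 0\<^sub>v m"
  proof (intro eq_vecI)
    fix i assume "i < dim_vec (0\<^sub>v m)"
    then have i: "i < m" by simp
    have "(mat m m (($$) H) *\<^sub>v w) $ i = (\<Sum>j\<in>{0..<m}. H $$ (i, j) * u $ j)"
      using i by (simp add: w_def scalar_prod_def)
    also have "\<dots> = (\<Sum>j\<in>{0..<n}. H $$ (i, j) * u $ j)"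
      using m tail by (intro sum.mono_neutral_left) auto
    also have "\<dots> = (H *\<^sub>v u) $ i"
      using i H u by (simp add: scalar_prod_def)
    finally show "(mat m m (($$) H) *\<^sub>v w) $ i = 0\<^sub>v m $ i"
      using Hu i by simp
  qed simp
  then have "w = 0\<^sub>v m"
    by (rule inj[rotated]) (simp add: w_def)
  then have head: "u $ j = 0" if "j < m" for j
    using that by (metis index_vec index_zero_vec(1) w_def)
  have "u = 0\<^sub>v n"
  proof (intro eq_vecI)
    fix j assume "j < dim_vec (0\<^sub>v n :: 'a vec)"
    then show "u $ j = 0\<^sub>v n $ j"
      using tail[of j] head[of j] by (cases "j < m") auto
  qed (use u in simp)
  then show ?thesis
    using v0 by blast
next
  case False
  have u0: "u = 0\<^sub>v n"
    using shift_mat_transpose_kernel[OF u False m0 Ku] .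
  show ?thesis
  proof (cases "a' = 0")
    case True
    then have nz: "b' \<noteq> 0" "c \<noteq> 0"
      using a' by auto
    \<comment> \<open>For \<open>a' = 0\<close> the product moves \<open>v\<close> down by
      \<open>m\<close> places; only the last block stays free, and \<open>last_block\<close> reads
      it off.\<close>
    have init: "v $ j = 0" if "j + m < n" for j
    proof -
      have "(shift_mat n m a' b' *\<^sub>v v) $ (j + m) = b' * v $ j"
        using shift_mat_mult_vec[OF v that m0, of a' b'] True by simp
      moreover have "(shift_mat n m a' b' *\<^sub>v v) $ (j + m) = 0"
        using that by (simp add: Kv)
      ultimately show ?thesis
        using nz by simp
    qed
    have "H *\<^sub>v u = 0\<^sub>v m"
      using H unfolding u0 by (intro eq_vecI) (auto simp: scalar_prod_def)
    then have "(last_block n m *\<^sub>v v) $ i = 0" if "i < m" for i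
      using arg_cong[OF uv, of "\<lambda>x. vec_index x i"] that nz(2) by simp
    then have last: "v $ (n - m + i) = 0" if "i < m" for i
      using that last_block_mult_vec[OF v that m] by simp
    have "v = 0\<^sub>v n"
    proof (intro eq_vecI)
      fix j assume "j < dim_vec (0\<^sub>v n :: 'a vec)"
      then show "v $ j = 0\<^sub>v n $ j"
        using init[of j] last[of "j - (n - m)"] m by (cases "j + m < n") auto
    qed (use v in simp)
    with u0 show ?thesis by blast
  next
    case False
    with u0 show ?thesis
      using shift_mat_kernel[OF v False m0 Kv] by blast
  qed
qed

section \<open>The Kronecker blocks, and block matrices applied to split vectors\<close>

lemma kronecker_e_last_transpose:
  assumes "d \<ge> 1"
  shows "kronecker (transpose_mat (e_last d)) (1\<^sub>m m) = last_block (d * m) m"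
proof (intro eq_matI)
  fix i j
  assume "i < dim_row (last_block (d * m) m :: complex mat)"
    and "j < dim_col (last_block (d * m) m :: complex mat)"
  then have i: "i < m" and j: "j < d * m"
    by (simp_all add: last_block_def)
  then have jd: "j div m < d"
    by (simp add: less_mult_imp_div_less)
  have "j = d * m - m + i \<longleftrightarrow> j = (d - 1) * m + i"
    by (simp add: diff_mult_distrib)
  also have "\<dots> \<longleftrightarrow> j div m = d - 1 \<and> i = j mod m"
    using i by (metis add.commute div_mult_mod_eq div_mult_self1 div_less mod_less mod_mult_self1
        add_0 not_less_zero)
  finally show "kronecker (transpose_mat (e_last d)) (1\<^sub>m m) $$ (i, j) = last_block (d * m) m $$ (i, j)"
    using i j jd
    by (auto simp: kronecker_def e_last_def last_block_def mat_of_cols_index unit_vec_def)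
qed (simp_all add: kronecker_def e_last_def last_block_def)

lemma kronecker_e_last:
  assumes "d \<ge> 1"
  shows "kronecker (e_last d) (1\<^sub>m m) = (last_block (d * m) m)\<^sup>T"
  unfolding kronecker_e_last_transpose[OF assms, symmetric]
  by (intro eq_matI) (auto simp: kronecker_def e_last_def mat_of_cols_index less_mult_imp_div_less)

lemma append_cols_mult_vec:
  assumes "X \<in> carrier_mat n a" "Y \<in> carrier_mat n b" "u \<in> carrier_vec a" "v \<in> carrier_vec b"
  shows "(X @\<^sub>c Y) *\<^sub>v (u @\<^sub>v v) = X *\<^sub>v u + Y *\<^sub>v v"
proof -
  \<comment> \<open>The lower blocks in the encoding of \<open>append_cols\<close> have no rows, so
    the product carries an empty second part, dropped afterwards.\<close>
  have "(X @\<^sub>c Y) *\<^sub>v (u @\<^sub>v v) = (X *\<^sub>v u + Y *\<^sub>v v) @\<^sub>v (0\<^sub>m 0 a *\<^sub>v u + 0\<^sub>m 0 b *\<^sub>v v)"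
    using assms unfolding append_cols_def by (subst four_block_mat_mult_vec[of _ n a _ b _ 0]) auto
  also have "\<dots> = X *\<^sub>v u + Y *\<^sub>v v"
    by (intro eq_vecI) auto
  finally show ?thesis .
qed

lemma antidiagonal_mult_vec:
  assumes "X \<in> carrier_mat n n" "Y \<in> carrier_mat n n" "u \<in> carrier_vec n" "v \<in> carrier_vec n"
  shows "four_block_mat (0\<^sub>m n n) X Y (0\<^sub>m n n) *\<^sub>v (u @\<^sub>v v) = (X *\<^sub>v v) @\<^sub>v (Y *\<^sub>v u)"
  using assms by (subst four_block_mat_mult_vec[of _ n n _ n _ n]) auto

section \<open>Strong minimality\<close>

lemma index_mat_adjoint [simp]:
  "i < dim_col M \<Longrightarrow> j < dim_row M \<Longrightarrow> mat_adjoint M $$ (i, j) = conjugate (M $$ (j, i))"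
  by (simp add: mat_adjoint_def mat_of_rows_index)

lemma dim_mat_adjoint [simp]:
  "dim_row (mat_adjoint M) = dim_col M" "dim_col (mat_adjoint M) = dim_row M"
  by (simp_all add: mat_adjoint_def)

lemma F_mat_carrier [simp]: "F_mat d m Rs \<in> carrier_mat (d * m) m"
  by (simp add: F_mat_def block_mat_def)

lemma F_mat_dim [simp]: "dim_row (F_mat d m Rs) = d * m" "dim_col (F_mat d m Rs) = m"
  by (simp_all add: F_mat_def block_mat_def)

lemma index_F_mat:
  "i < d * m \<Longrightarrow> j < m \<Longrightarrow> F_mat d m Rs $$ (i, j) = Rs (d - i div m) $$ (i mod m, j)"
  by (simp add: F_mat_def block_mat_def)

text \<open>The minus sign compensates for the system matrix having \<open>-A\<close> as its
  top-left block. Using \<open>rev_star_pencil\<close> instead of \<open>rev1\<close> keeps the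
  block a polynomial matrix.\<close>

definition A_lam :: "nat \<Rightarrow> nat \<Rightarrow> complex \<Rightarrow> complex poly mat" where
  "A_lam d m lam = - four_block_mat (0\<^sub>m (d * m) (d * m)) (K_lam d m lam)
     (rev_star_pencil (K_lam d m lam)) (0\<^sub>m (d * m) (d * m))"

definition B_lam :: "nat \<Rightarrow> nat \<Rightarrow> (nat \<Rightarrow> complex mat) \<Rightarrow> complex poly mat" where
  "B_lam d m Rs = map_mat (\<lambda>c. [:c:]) (F_mat d m Rs) @\<^sub>r
     map_mat (\<lambda>c. [:c, c:]) (last_block (d * m) m)\<^sup>T"

definition C_lam :: "nat \<Rightarrow> nat \<Rightarrow> (nat \<Rightarrow> complex mat) \<Rightarrow> complex poly mat" where
  "C_lam d m Rs = map_mat (\<lambda>c. [:0, c:]) (mat_adjoint (F_mat d m Rs)) @\<^sub>c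
     map_mat (\<lambda>c. [:c, c:]) (last_block (d * m) m)"

definition D_lam :: "(nat \<Rightarrow> complex mat) \<Rightarrow> complex poly mat" where
  "D_lam Rs = map_mat (\<lambda>c. [:c, c:]) (Rs 0)"

lemma rev_star_pencil_shift_mat:
  "rev_star_pencil (shift_mat n m p q) = (shift_mat n m (rev_star_poly p) (rev_star_poly q))\<^sup>T"
  by (simp add: rev_star_pencil_def map_shift_mat rev_star_poly_def)

text \<open>By \<open>z (cnj lam - 1/z) = cnj lam z - 1\<close> the root of the diagonal entry is
  reflected in the unit circle, and the identity blocks become \<open>z I_m\<close>.\<close>

lemma rev_star_K_lam:
  "rev_star_pencil (K_lam d m lam) = (shift_mat (d * m) m [:-1, cnj lam:] [:0, 1:])\<^sup>T"
  by (simp add: K_lam_eq_shift_mat rev_star_pencil_shift_mat) (simp add: rev_star_poly_def)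

lemma pencil_zero [simp]: "pencil (0\<^sub>m n k)"
  by (simp add: pencil_def)

lemma pencil_four_block_mat:
  assumes "pencil A" "pencil B" "pencil C" "pencil D"
    and "A \<in> carrier_mat nr1 nc1" "B \<in> carrier_mat nr1 nc2"
    "C \<in> carrier_mat nr2 nc1" "D \<in> carrier_mat nr2 nc2"
  shows "pencil (four_block_mat A B C D)"
  using assms by (auto simp: pencil_def)

lemma pencil_rev_star_pencil [simp]: "pencil (rev_star_pencil P)"
  by (auto simp: pencil_def rev_star_pencil_def rev_star_poly_def)

lemma pencil_K_lam: "pencil (K_lam d m lam)"
  by (auto simp: pencil_def K_lam_eq_shift_mat)

lemma K_lam_carrier [simp]: "K_lam d m lam \<in> carrier_mat (d * m) (d * m)"
  by (simp add: K_lam_eq_shift_mat)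

lemma rev_star_pencil_carrier [simp]:
  "P \<in> carrier_mat n k \<Longrightarrow> rev_star_pencil P \<in> carrier_mat k n"
  by (simp add: rev_star_pencil_def)

lemma invertible_mat_kernel:
  fixes T :: "'a :: comm_ring_1 mat"
  assumes T: "T \<in> carrier_mat m m" and inv: "invertible_mat T"
    and w: "w \<in> carrier_vec m" and 0: "T\<^sup>T *\<^sub>v w = 0\<^sub>v m"
  shows "w = 0\<^sub>v m"
proof -
  obtain B where B: "T * B = 1\<^sub>m m" "B * T = 1\<^sub>m (dim_row B)"
    using inv T by (auto simp: invertible_mat_def inverts_mat_def)
  have "dim_col B = m" "dim_col T = dim_row B"
    using arg_cong[OF B(1), of dim_col] arg_cong[OF B(2), of dim_col] by simp_all
  then have Bc: "B \<in> carrier_mat m m"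
    using T by auto
  have "w = (T * B)\<^sup>T *\<^sub>v w"
    using B w by simp
  also have "\<dots> = B\<^sup>T *\<^sub>v (T\<^sup>T *\<^sub>v w)"
    using T Bc w by (simp add: transpose_mult[OF T Bc])
  also have "\<dots> = 0\<^sub>v m"
    using Bc unfolding 0 by (intro eq_vecI) (auto simp: scalar_prod_def)
  finally show ?thesis .
qed

text \<open>Conjugating the equation turns the adjoint into the transpose, whose kernel is already
  known to be trivial.\<close>

lemma invertible_mat_adjoint_kernel:
  fixes T :: "complex mat"
  assumes T: "T \<in> carrier_mat m m" and inv: "invertible_mat T"
    and w: "w \<in> carrier_vec m" and 0: "mat_adjoint T *\<^sub>v w = 0\<^sub>v m"
  shows "w = 0\<^sub>v m"
proof -
  have "T\<^sup>T *\<^sub>v conjugate w = 0\<^sub>v m"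
    using conjugate_mat_adjoint_mult_vec[OF T w] by (simp add: 0)
  then have "conjugate w = 0\<^sub>v m"
    using invertible_mat_kernel[OF T inv, of "conjugate w"] w by simp
  then have "conjugate (conjugate w) = 0\<^sub>v m"
    by simp
  then show ?thesis
    by simp
qed

lemma smult_mat_mult_vec:
  fixes A :: "'a :: comm_semiring_0 mat"
  assumes "A \<in> carrier_mat n k" "v \<in> carrier_vec k"
  shows "(c \<cdot>\<^sub>m A) *\<^sub>v v = c \<cdot>\<^sub>v (A *\<^sub>v v)"
  using assms by (intro eq_vecI) (auto simp: scalar_prod_def sum_distrib_left mult.assoc)

text \<open>The functionals \<open>p \<mapsto> p(z\<^sub>0)\<close> and \<open>p \<mapsto> coeff p 1\<close> are treated at once:
  a linear functional \<open>\<phi>\<close> on pencils that does not vanish identically is evaluation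
  at the point \<open>(\<phi> 1 : \<phi> z)\<close> of the projective line.\<close>

lemma minimal_at_functional:
  fixes phi :: "complex poly \<Rightarrow> complex"
  assumes lam: "cmod lam < 1" and d: "d \<ge> 1"
    and Rd: "Rs d \<in> carrier_mat m m" and inv: "invertible_mat (Rs d)"
    and phi: "\<And>a b. phi [:a, b:] = a * s + b * t"
    and st: "s \<noteq> 0 \<or> t \<noteq> 0"
  shows "full_row_rank (- map_mat phi (A_lam d m lam) @\<^sub>c map_mat phi (B_lam d m Rs)) \<and>
    full_col_rank (- map_mat phi (A_lam d m lam) @\<^sub>r map_mat phi (C_lam d m Rs))"
proof -
  define n where "n = d * m"
  \<comment> \<open>\<open>a\<close> and \<open>a'\<close> are the values at \<open>(s : t)\<close>
    of the diagonal entries \<open>lam - z\<close> and \<open>cnj lam z - 1\<close>.\<close>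
  define a where "a = lam * s - t"
  define a' where "a' = cnj lam * t - s"
  define K where "K = shift_mat n m a s"
  define K' where "K' = shift_mat n m a' t"
  define X where "X = four_block_mat (0\<^sub>m n n) K K'\<^sup>T (0\<^sub>m n n)"
  define F where "F = F_mat d m Rs"
  define E where "E = (last_block n m :: complex mat)"
  have phi0: "phi 0 = 0" and phi1: "phi 1 = s" and phiC: "phi [:c:] = c * s" for c
    using phi[of 0 0] phi[of 1 0] phi[of c 0] by (simp_all add: one_pCons)
  have car: "K \<in> carrier_mat n n" "K' \<in> carrier_mat n n" "F \<in> carrier_mat n m"
    "E \<in> carrier_mat m n" "X \<in> carrier_mat (n + n) (n + n)" "mat_adjoint F \<in> carrier_mat m n"
    by (auto simp: K_def K'_def F_def E_def X_def n_def intro!: carrier_matI)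
  \<comment> \<open>\<open>phi\<close> is known only up to degree one, so moving the sign of
    \<open>A_lam\<close> through it relies on the entries being linear.\<close>
  have phim: "phi (- p) = - phi p" if "degree p \<le> 1" for p
  proof -
    have "p = [:coeff p 0, coeff p 1:]"
      using that by (rule linear_poly_eq)
    then obtain u v where "p = [:u, v:]" by blast
    then show ?thesis
      by (simp add: phi)
  qed
  have A: "- map_mat phi (A_lam d m lam) = X"
  proof -
    have K: "map_mat phi (K_lam d m lam) = K"
      by (simp add: K_lam_eq_shift_mat n_def map_shift_mat phi0 phi phi1 K_def a_def)
    have K': "map_mat phi (rev_star_pencil (K_lam d m lam)) = K'\<^sup>T"
      by (simp add: rev_star_K_lam n_def map_shift_mat phi0 phi K'_def a'_def flip: map_mat_transpose)
    define P where "P = four_block_mat (0\<^sub>m n n) (K_lam d m lam) (rev_star_pencil (K_lam d m lam)) (0\<^sub>m n n)"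
    have "pencil P"
      unfolding P_def n_def
      by (rule pencil_four_block_mat[of _ _ _ _ "d * m" "d * m" "d * m" "d * m"])
        (simp_all add: pencil_K_lam)
    then have "- map_mat phi (- P) = map_mat phi P"
      by (intro eq_matI) (auto simp: phim pencil_def)
    also have "map_mat phi P = X"
      unfolding P_def X_def n_def
      by (subst map_four_block_mat[of _ "d * m" "d * m" _ "d * m" _ "d * m"])
        (auto simp: K K' phi0 n_def intro!: cong_four_block_mat eq_matI)
    finally show ?thesis
      by (simp add: A_lam_def P_def n_def)
  qed
  have B: "map_mat phi (B_lam d m Rs) = s \<cdot>\<^sub>m F @\<^sub>r (s + t) \<cdot>\<^sub>m E\<^sup>T"
    unfolding B_lam_def
    by (intro eq_matI)
      (auto simp: append_rows_def phi phiC F_def E_def n_def algebra_simps)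
  have C: "map_mat phi (C_lam d m Rs) = t \<cdot>\<^sub>m mat_adjoint F @\<^sub>c (s + t) \<cdot>\<^sub>m E"
    unfolding C_lam_def
    by (intro eq_matI)
      (auto simp: append_cols_def phi F_def E_def n_def algebra_simps)
  \<comment> \<open>These say that \<open>1 + z\<close> vanishes at neither singular point and that
    the two points are distinct.\<close>
  have lam_neq: "lam \<noteq> -1" "cnj lam \<noteq> -1" "lam * cnj lam \<noteq> 1"
  proof -
    show "lam \<noteq> -1" "cnj lam \<noteq> -1"
      using lam complex_mod_cnj[of lam] norm_minus_cancel[of "1 :: complex"] by (auto simp del: complex_mod_cnj)
    show "lam * cnj lam \<noteq> 1"
    proof
      assume "lam * cnj lam = 1"
      then have "cmod lam * cmod lam = 1"
        by (metis complex_mod_cnj norm_mult norm_one)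
      then show False
        using lam norm_ge_zero[of lam] by (auto simp: square_eq_1_iff simp del: norm_ge_zero)
    qed
  qed
  \<comment> \<open>The singular points are \<open>(1 : lam)\<close> and
    \<open>(cnj lam : 1)\<close>. \<open>K\<close> is the transposed factor in the row condition and
    \<open>K'\<close> in the column condition, so \<open>a0\<close> and \<open>a'0\<close> each
    serve once for the hypothesis on \<open>a\<close> and once for that on \<open>a'\<close> in the
    kernel lemma.\<close>
  have a0: "s \<noteq> 0 \<and> a' \<noteq> 0 \<and> s + t \<noteq> 0" if "a = 0"
  proof -
    have t: "t = lam * s"
      using that by (simp add: a_def)
    then have s: "s \<noteq> 0" using st by auto
    moreover have "a' = (lam * cnj lam - 1) * s" "s + t = (1 + lam) * s"
      by (simp_all add: a'_def t algebra_simps)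
    ultimately show ?thesis
      using lam_neq by (simp add: add_eq_0_iff)
  qed
  have a'0: "t \<noteq> 0 \<and> a \<noteq> 0 \<and> s + t \<noteq> 0" if "a' = 0"
  proof -
    have s: "s = cnj lam * t"
      using that by (simp add: a'_def)
    then have t: "t \<noteq> 0" using st by auto
    moreover have "a = (lam * cnj lam - 1) * t" "s + t = (1 + cnj lam) * t"
      by (simp_all add: a_def s algebra_simps)
    ultimately show ?thesis
      using lam_neq by (simp add: add_eq_0_iff)
  qed
  have mn: "m \<le> n" using d by (simp add: n_def)
  have lt: "i < d * m" if "i < m" for i
    using mn that by (simp only: n_def)
  \<comment> \<open>\<open>F\<close> lists the coefficients in decreasing order, so
    \<open>R_d\<close> is exactly what meets a vector supported on the first block.\<close>
  have head: "mat m m (($$) F\<^sup>T) = (Rs d)\<^sup>T" "mat m m (($$) (mat_adjoint F)) = mat_adjoint (Rs d)"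
    using Rd d by (auto simp: F_def index_F_mat n_def lt intro!: eq_matI)
  have split: "\<exists>u v. w = u @\<^sub>v v \<and> u \<in> carrier_vec n \<and> v \<in> carrier_vec n"
    if "w \<in> carrier_vec (n + n)" for w :: "complex vec"
    using that by (metis vec_first_last_append vec_first_carrier vec_last_carrier)
  have XT: "X\<^sup>T = four_block_mat (0\<^sub>m n n) K' K\<^sup>T (0\<^sub>m n n)"
    unfolding X_def using car by (subst transpose_four_block_mat[of _ n n _ n _ n]) auto
  have row: "w = 0\<^sub>v (n + n)"
    if w: "w \<in> carrier_vec (n + n)" and 1: "X\<^sup>T *\<^sub>v w = 0\<^sub>v (n + n)"
      and 2: "(s \<cdot>\<^sub>m F @\<^sub>r (s + t) \<cdot>\<^sub>m E\<^sup>T)\<^sup>T *\<^sub>v w = 0\<^sub>v m" for w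
  proof -
    obtain u v where uv: "w = u @\<^sub>v v" "u \<in> carrier_vec n" "v \<in> carrier_vec n"
      using split[OF w] by blast
    have "(K' *\<^sub>v v) @\<^sub>v (K\<^sup>T *\<^sub>v u) = 0\<^sub>v (n + n)"
      using 1 uv car by (simp add: XT antidiagonal_mult_vec)
    then have K: "K' *\<^sub>v v = 0\<^sub>v n" "K\<^sup>T *\<^sub>v u = 0\<^sub>v n"
      using car uv by (subst (asm) append_vec_eq_zero_iff; auto)+
    have "(s \<cdot>\<^sub>m F @\<^sub>r (s + t) \<cdot>\<^sub>m E\<^sup>T)\<^sup>T = s \<cdot>\<^sub>m F\<^sup>T @\<^sub>c (s + t) \<cdot>\<^sub>m E"
      unfolding append_rows_def append_cols_def
      using car by (subst transpose_four_block_mat[of _ n m _ 0 _ n]) (auto intro!: eq_matI)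
    then have L: "s \<cdot>\<^sub>v (F\<^sup>T *\<^sub>v u) + (s + t) \<cdot>\<^sub>v (E *\<^sub>v v) = 0\<^sub>v m"
      using 2 car uv append_cols_mult_vec[of "s \<cdot>\<^sub>m F\<^sup>T" m n "(s + t) \<cdot>\<^sub>m E" n u v]
      by (simp add: smult_mat_mult_vec[of _ m n])
    have "u = 0\<^sub>v n \<and> v = 0\<^sub>v n"
    \<comment> \<open>The kernel lemma needs a positive offset; for \<open>m = 0\<close> all vectors
      are empty.\<close>
    proof (cases "m = 0")
      case True
      then show ?thesis using uv by (auto simp: n_def)
    next
      case False
      show ?thesis
        by (rule block_bidiagonal_kernel[OF mn uv(2,3) _ _ K(2)[unfolded K_def]
            K(1)[unfolded K'_def] L[unfolded E_def]])
          (use car False a0 a'0 invertible_mat_kernel[OF Rd inv] in \<open>auto simp: head\<close>)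
    qed
    then show ?thesis by (simp add: uv)
  qed
  \<comment> \<open>Now \<open>K'\<close> is the transposed factor, and \<open>F\<close> enters
    through its adjoint with weight \<open>t\<close> instead of \<open>s\<close>.\<close>
  have col: "w = 0\<^sub>v (n + n)"
    if w: "w \<in> carrier_vec (n + n)" and 1: "X *\<^sub>v w = 0\<^sub>v (n + n)"
      and 2: "(t \<cdot>\<^sub>m mat_adjoint F @\<^sub>c (s + t) \<cdot>\<^sub>m E) *\<^sub>v w = 0\<^sub>v m" for w
  proof -
    obtain u v where uv: "w = u @\<^sub>v v" "u \<in> carrier_vec n" "v \<in> carrier_vec n"
      using split[OF w] by blast
    have "(K *\<^sub>v v) @\<^sub>v (K'\<^sup>T *\<^sub>v u) = 0\<^sub>v (n + n)"
      using 1 uv car by (simp add: X_def antidiagonal_mult_vec)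
    then have K: "K *\<^sub>v v = 0\<^sub>v n" "K'\<^sup>T *\<^sub>v u = 0\<^sub>v n"
      using car uv by (subst (asm) append_vec_eq_zero_iff; auto)+
    have L: "t \<cdot>\<^sub>v (mat_adjoint F *\<^sub>v u) + (s + t) \<cdot>\<^sub>v (E *\<^sub>v v) = 0\<^sub>v m"
      using 2 car uv append_cols_mult_vec[of "t \<cdot>\<^sub>m mat_adjoint F" m n "(s + t) \<cdot>\<^sub>m E" n u v]
      by (simp add: smult_mat_mult_vec[of _ m n])
    have "u = 0\<^sub>v n \<and> v = 0\<^sub>v n"
    proof (cases "m = 0")
      case True
      then show ?thesis using uv by (auto simp: n_def)
    next
      case False
      show ?thesis
        by (rule block_bidiagonal_kernel[OF mn uv(2,3) _ _ K(2)[unfolded K'_def]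
            K(1)[unfolded K_def] L[unfolded E_def]])
          (use car False a0 a'0 invertible_mat_adjoint_kernel[OF Rd inv] in \<open>auto simp: head\<close>)
    qed
    then show ?thesis by (simp add: uv)
  qed
  have "s \<cdot>\<^sub>m F @\<^sub>r (s + t) \<cdot>\<^sub>m E\<^sup>T \<in> carrier_mat (n + n) m"
    using car by (intro carrier_append_rows) simp_all
  moreover have "t \<cdot>\<^sub>m mat_adjoint F @\<^sub>c (s + t) \<cdot>\<^sub>m E \<in> carrier_mat m (n + n)"
    using car by (auto simp: append_cols_def intro!: carrier_matI)
  ultimately show ?thesis
    unfolding A B C
    using full_row_rank_append_colsI[OF car(5) _ row] full_col_rank_append_rowsI[OF car(5) _ col]
    by blast
qed

lemma minimal_system_lam:
  assumes "cmod lam < 1" "d \<ge> 1" "Rs d \<in> carrier_mat m m" "invertible_mat (Rs d)"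
  shows "minimal_system (A_lam d m lam) (B_lam d m Rs) (C_lam d m Rs)"
  unfolding minimal_system_def eval_pm_def
  by (intro allI minimal_at_functional[where s = 1]) (use assms in \<open>auto simp: mult.commute\<close>)

lemma minimal_at_infinity_lam:
  assumes "cmod lam < 1" "d \<ge> 1" "Rs d \<in> carrier_mat m m" "invertible_mat (Rs d)"
  shows "minimal_at_infinity (A_lam d m lam) (B_lam d m Rs) (C_lam d m Rs)"
  unfolding minimal_at_infinity_def lead_pm_def
  by (intro minimal_at_functional[where s = 0 and t = 1]) (use assms in auto)

section \<open>Palindromic structure\<close>

lemma to_fract_one_plus_z: "to_fract [:c, c:] = (1 + zvar) * const_rf c"
  using to_fract_linear[of c c] by (simp add: algebra_simps)

lemma zvar_mult_const_rf: "zvar * const_rf c = to_fract [:0, c:]"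
  using to_fract_linear[of 0 c] by (simp add: mult.commute)

lemma rev_star_poly_rev_star_poly:
  "degree p \<le> 1 \<Longrightarrow> rev_star_poly (rev_star_poly p) = p"
  using linear_poly_eq[of p] by (simp add: rev_star_poly_def)

lemma rev_star_pencil_rev_star_pencil:
  "pencil P \<Longrightarrow> rev_star_pencil (rev_star_pencil P) = P"
  by (intro eq_matI) (auto simp: rev_star_pencil_def pencil_def rev_star_poly_rev_star_poly)

lemma rev_star_pencil_four_block_mat:
  assumes "A \<in> carrier_mat nr1 nc1" "B \<in> carrier_mat nr1 nc2"
    and "C \<in> carrier_mat nr2 nc1" "D \<in> carrier_mat nr2 nc2"
  shows "rev_star_pencil (four_block_mat A B C D) =
    four_block_mat (rev_star_pencil A) (rev_star_pencil C) (rev_star_pencil B) (rev_star_pencil D)"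
  using assms by (intro eq_matI) (auto simp: rev_star_pencil_def)

lemma rev_star_pencil_zero [simp]: "rev_star_pencil (0\<^sub>m n k) = 0\<^sub>m k n"
  by (intro eq_matI) (auto simp: rev_star_pencil_def rev_star_poly_def)

lemma A_lam_carrier [simp]: "A_lam d m lam \<in> carrier_mat (d * m + d * m) (d * m + d * m)"
  by (auto simp: A_lam_def intro!: four_block_carrier_mat)

lemma A_lam_dim [simp]:
  "dim_row (A_lam d m lam) = d * m + d * m" "dim_col (A_lam d m lam) = d * m + d * m"
  using A_lam_carrier[of d m lam] by (simp_all del: A_lam_carrier)

lemma B_lam_carrier [simp]: "B_lam d m Rs \<in> carrier_mat (d * m + d * m) m"
  by (auto simp: B_lam_def intro!: carrier_append_rows)

lemma C_lam_carrier [simp]: "C_lam d m Rs \<in> carrier_mat m (d * m + d * m)"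
  by (auto simp: C_lam_def append_cols_def intro!: carrier_matI)

lemma uminus_A_lam:
  "- A_lam d m lam = four_block_mat (0\<^sub>m (d * m) (d * m)) (K_lam d m lam)
     (rev_star_pencil (K_lam d m lam)) (0\<^sub>m (d * m) (d * m))"
  unfolding A_lam_def by simp

lemma pencil_uminus_A_lam: "pencil (- A_lam d m lam)"
  unfolding uminus_A_lam
  by (rule pencil_four_block_mat[of _ _ _ _ "d * m" "d * m" "d * m" "d * m"])
    (simp_all add: pencil_K_lam)

lemma pencil_A_lam: "pencil (A_lam d m lam)"
  using pencil_uminus_A_lam[of d m lam] by (simp add: pencil_def)

lemma pencil_B_lam: "pencil (B_lam d m Rs)"
  by (auto simp: pencil_def B_lam_def append_rows_def)

lemma pencil_C_lam: "pencil (C_lam d m Rs)"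
  by (auto simp: pencil_def C_lam_def append_cols_def)

lemma pencil_D_lam: "pencil (D_lam Rs)"
  by (auto simp: pencil_def D_lam_def)

text \<open>The operation exchanges the two antidiagonal blocks, and since it is an involution on
  pencils each block is the image of the other.\<close>

lemma rev_star_uminus_A_lam: "rev_star_pencil (- A_lam d m lam) = - A_lam d m lam"
  unfolding uminus_A_lam
  by (subst rev_star_pencil_four_block_mat[of _ "d * m" "d * m" _ "d * m" _ "d * m"])
    (simp_all add: rev_star_pencil_rev_star_pencil pencil_K_lam)

lemma rev_star_B_lam: "rev_star_pencil (B_lam d m Rs) = C_lam d m Rs"
  by (intro eq_matI)
    (auto simp: rev_star_pencil_def rev_star_poly_def B_lam_def C_lam_def append_rows_def
      append_cols_def last_block_def)

lemma rev_star_C_lam: "rev_star_pencil (C_lam d m Rs) = B_lam d m Rs"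
  unfolding rev_star_B_lam[symmetric] by (rule rev_star_pencil_rev_star_pencil[OF pencil_B_lam])

lemma rev_star_D_lam:
  assumes "mat_adjoint (Rs 0) = Rs 0"
  shows "rev_star_pencil (D_lam Rs) = D_lam Rs"
proof -
  have dim: "dim_row (Rs 0) = dim_col (Rs 0)"
    using arg_cong[OF assms, of dim_row] by simp
  have "cnj (Rs 0 $$ (j, i)) = Rs 0 $$ (i, j)" if "i < dim_col (Rs 0)" "j < dim_col (Rs 0)" for i j
    using index_mat_adjoint[of i "Rs 0" j] that dim assms by simp
  then show ?thesis
    using dim by (intro eq_matI) (auto simp: rev_star_pencil_def rev_star_poly_def D_lam_def)
qed

lemma L_lam_eq:
  assumes "d \<ge> 1" and R0: "Rs 0 \<in> carrier_mat m m"
  shows "L_lam d m lam Rs =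
    poly_rm (system_matrix (A_lam d m lam) (B_lam d m Rs) (C_lam d m Rs) (D_lam Rs))"
proof -
  have D: "D_lam Rs \<in> carrier_mat m m"
    using R0 by (simp add: D_lam_def)
  have "poly_rm (- A_lam d m lam) = four_block_mat (0\<^sub>m (d * m) (d * m)) (poly_rm (K_lam d m lam))
      (rev1 (rm_star (poly_rm (K_lam d m lam)))) (0\<^sub>m (d * m) (d * m))"
    unfolding uminus_A_lam
    by (subst map_four_block_mat[of _ "d * m" "d * m" _ "d * m" _ "d * m"])
      (auto simp: rev1_rm_star_poly_rm pencil_K_lam intro!: cong_four_block_mat eq_matI)
  moreover have "poly_rm (B_lam d m Rs) = const_rm (F_mat d m Rs) @\<^sub>r
      ((1 + zvar) \<cdot>\<^sub>m const_rm (kronecker (e_last d) (1\<^sub>m m)))"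
    by (intro eq_matI)
      (auto simp: B_lam_def append_rows_def kronecker_e_last[OF assms(1)] to_fract_one_plus_z)
  moreover have "poly_rm (C_lam d m Rs) = (zvar \<cdot>\<^sub>m const_rm (mat_adjoint (F_mat d m Rs))) @\<^sub>c
      ((1 + zvar) \<cdot>\<^sub>m const_rm (kronecker (transpose_mat (e_last d)) (1\<^sub>m m)))"
    by (intro eq_matI)
      (auto simp: C_lam_def append_cols_def kronecker_e_last_transpose[OF assms(1)] to_fract_one_plus_z
        zvar_mult_const_rf)
  moreover have "poly_rm (D_lam Rs) = (1 + zvar) \<cdot>\<^sub>m const_rm (Rs 0)"
    by (intro eq_matI) (auto simp: D_lam_def to_fract_one_plus_z)
  moreover have "poly_rm (system_matrix (A_lam d m lam) (B_lam d m Rs) (C_lam d m Rs) (D_lam Rs)) =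
     four_block_mat (poly_rm (- A_lam d m lam)) (poly_rm (B_lam d m Rs)) (poly_rm (C_lam d m Rs))
       (poly_rm (D_lam Rs))"
    unfolding system_matrix_def using D
    by (intro map_four_block_mat[of _ "d * m + d * m" "d * m + d * m" _ m _ m]) simp_all
  ultimately show ?thesis
    by (simp add: L_lam_def Let_def)
qed

lemma star_palindromic_L_lam:
  assumes "d \<ge> 1" and R0: "Rs 0 \<in> carrier_mat m m" "mat_adjoint (Rs 0) = Rs 0"
  shows "star_palindromic (L_lam d m lam Rs)"
proof -
  define P where "P = system_matrix (A_lam d m lam) (B_lam d m Rs) (C_lam d m Rs) (D_lam Rs)"
  have D: "D_lam Rs \<in> carrier_mat m m"
    using R0 by (simp add: D_lam_def)
  have P: "pencil P"
    unfolding P_def system_matrix_def using D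
    by (intro pencil_four_block_mat[of _ _ _ _ "d * m + d * m" "d * m + d * m" m m]
        pencil_uminus_A_lam pencil_B_lam pencil_C_lam pencil_D_lam) simp_all
  have "rev_star_pencil P = P"
    unfolding P_def system_matrix_def using D
    by (subst rev_star_pencil_four_block_mat[of _ "d * m + d * m" "d * m + d * m" _ m _ m])
      (simp_all add: rev_star_uminus_A_lam rev_star_B_lam rev_star_C_lam rev_star_D_lam R0)
  then have "rev1 (rm_star (poly_rm P)) = poly_rm P"
    by (simp add: rev1_rm_star_poly_rm[OF P])
  moreover have "square_mat (poly_rm P)"
    using D by (simp add: P_def system_matrix_def)
  ultimately show ?thesis
    unfolding star_palindromic_def L_lam_eq[of d Rs m, OF assms(1,2)] P_def[symmetric]
    using P by blast
qed

section \<open>The transfer function\<close>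

lemma poly_rm_A_lam_mult_vec:
  assumes u: "u \<in> carrier_vec (d * m)" and v: "v \<in> carrier_vec (d * m)"
  shows "poly_rm (A_lam d m lam) *\<^sub>v (u @\<^sub>v v) =
    - ((shift_mat (d * m) m (to_fract [:lam, -1:]) 1 *\<^sub>v v) @\<^sub>v
       ((shift_mat (d * m) m (to_fract [:-1, cnj lam:]) zvar)\<^sup>T *\<^sub>v u))"
proof -
  let ?n = "d * m"
  let ?X = "four_block_mat (0\<^sub>m ?n ?n) (shift_mat ?n m (to_fract [:lam, -1:]) 1)
    (shift_mat ?n m (to_fract [:-1, cnj lam:]) zvar)\<^sup>T (0\<^sub>m ?n ?n)"
  have "poly_rm (K_lam d m lam) = shift_mat ?n m (to_fract [:lam, -1:]) 1"
    by (simp add: K_lam_eq_shift_mat map_shift_mat)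
  moreover have "poly_rm (rev_star_pencil (K_lam d m lam)) =
      (shift_mat ?n m (to_fract [:-1, cnj lam:]) zvar)\<^sup>T"
    by (simp add: rev_star_K_lam map_shift_mat flip: map_mat_transpose)
  moreover have "poly_rm (- A_lam d m lam) = four_block_mat (0\<^sub>m ?n ?n) (poly_rm (K_lam d m lam))
      (poly_rm (rev_star_pencil (K_lam d m lam))) (0\<^sub>m ?n ?n)"
    unfolding uminus_A_lam
    by (subst map_four_block_mat[of _ ?n ?n _ ?n _ ?n]) (auto intro!: cong_four_block_mat eq_matI)
  ultimately have "poly_rm (- A_lam d m lam) = ?X"
    by simp
  moreover have "poly_rm (A_lam d m lam) = - poly_rm (- A_lam d m lam)"
    by (intro eq_matI) auto
  ultimately have "poly_rm (A_lam d m lam) = - ?X"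
    by simp
  moreover have "- ?X *\<^sub>v (u @\<^sub>v v) = - (?X *\<^sub>v (u @\<^sub>v v))"
    using u v by (subst uminus_mult_mat_vec) auto
  ultimately show ?thesis
    using u v by (simp add: antidiagonal_mult_vec)
qed

text \<open>Over the field of rational functions both diagonal entries are nonzero, so substitution
  leaves only the zero vector in the kernel.\<close>

lemma det_poly_rm_A_lam:
  assumes "m > 0"
  shows "det (poly_rm (A_lam d m lam)) \<noteq> 0"
proof
  let ?n = "d * m"
  have c: "poly_rm (A_lam d m lam) \<in> carrier_mat (?n + ?n) (?n + ?n)"
    by simp
  assume "det (poly_rm (A_lam d m lam)) = 0"
  then obtain w where w: "w \<in> carrier_vec (?n + ?n)" "w \<noteq> 0\<^sub>v (?n + ?n)"
    "poly_rm (A_lam d m lam) *\<^sub>v w = 0\<^sub>v (?n + ?n)"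
    using det_0_iff_vec_prod_zero_field[OF c] by blast
  obtain u v where uv: "w = u @\<^sub>v v" "u \<in> carrier_vec ?n" "v \<in> carrier_vec ?n"
    using w(1) by (metis vec_first_last_append vec_first_carrier vec_last_carrier)
  let ?K = "shift_mat ?n m (to_fract [:lam, -1:]) 1"
  let ?K' = "shift_mat ?n m (to_fract [:-1, cnj lam:]) zvar"
  have kv: "?K *\<^sub>v v \<in> carrier_vec ?n" and ku: "?K'\<^sup>T *\<^sub>v u \<in> carrier_vec ?n"
    using mult_mat_vec_carrier[OF shift_mat_carrier uv(3)]
      mult_mat_vec_carrier[OF transpose_carrier_mat[THEN iffD2, OF shift_mat_carrier] uv(2)] by blast+
  have "- ((?K *\<^sub>v v) @\<^sub>v (?K'\<^sup>T *\<^sub>v u)) = 0\<^sub>v (?n + ?n)"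
    using w(3) unfolding uv(1) poly_rm_A_lam_mult_vec[OF uv(2,3)] .
  then have "(?K *\<^sub>v v) @\<^sub>v (?K'\<^sup>T *\<^sub>v u) = 0\<^sub>v (?n + ?n)"
    using kv ku uminus_zero_vec_eq append_carrier_vec[OF kv ku] by blast
  then have "?K *\<^sub>v v = 0\<^sub>v ?n" "?K'\<^sup>T *\<^sub>v u = 0\<^sub>v ?n"
    using append_vec_eq_zero_iff[OF kv ku] by blast+
  moreover have "to_fract [:lam, -1:] \<noteq> 0" "to_fract [:-1, cnj lam:] \<noteq> 0"
    by simp_all
  ultimately have "v = 0\<^sub>v ?n" "u = 0\<^sub>v ?n"
    using shift_mat_kernel[OF uv(3) _ assms] shift_mat_transpose_kernel[OF uv(2) _ assms] by blast+
  then show False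
    using w(2) uv(1) by simp
qed

lemma det_A_lam: "det (A_lam d m lam) \<noteq> 0"
proof (cases "m = 0")
  case True
  then have "A_lam d m lam \<in> carrier_mat 0 0"
    using A_lam_carrier[of d m lam] by simp
  then show ?thesis
    using det_dim_zero by fastforce
next
  case False
  interpret to_fract: comm_ring_hom "to_fract :: complex poly \<Rightarrow> ratfun"
    by unfold_locales simp_all
  show ?thesis
    using det_poly_rm_A_lam[of m d lam] False by auto
qed

section \<open>Transfer functions from explicit solutions of linear systems\<close>

lemma mat_inverse_mult:
  fixes A :: "'a :: field mat"
  assumes A: "A \<in> carrier_mat n n" and det: "det A \<noteq> 0"
  shows "the (mat_inverse A) \<in> carrier_mat n n" "the (mat_inverse A) * A = 1\<^sub>m n"
proof -
  obtain X where "mat_inverse A = Some X"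
    using mat_inverse(1)[OF A, of "()"] det_non_zero_imp_unit[OF A det, of "()"]
    by (cases "mat_inverse A") auto
  then show "the (mat_inverse A) \<in> carrier_mat n n" "the (mat_inverse A) * A = 1\<^sub>m n"
    using mat_inverse(2)[OF A] by auto
qed

text \<open>Invertibility of \<open>A\<close> makes any solutions \<open>y q\<close> the columns of
  \<open>A\<^sup>-\<^sup>1 B\<close>, so the inverse itself is never computed.\<close>

lemma transfer_functionI:
  assumes A: "A \<in> carrier_mat n n" and det: "det A \<noteq> 0"
    and B: "B \<in> carrier_mat n k" and C: "C \<in> carrier_mat l n"
    and D: "D \<in> carrier_mat l k" and H: "H \<in> carrier_mat l k"
    and y: "\<And>q. q < k \<Longrightarrow> y q \<in> carrier_vec n"
    and Ay: "\<And>q. q < k \<Longrightarrow> poly_rm A *\<^sub>v y q = col (poly_rm B) q"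
    and Cy: "\<And>r q. r < l \<Longrightarrow> q < k \<Longrightarrow>
      H $$ (r, q) = to_fract (D $$ (r, q)) + (poly_rm C *\<^sub>v y q) $ r"
  shows "transfer_function A B C D = H"
proof -
  interpret to_fract: comm_ring_hom "to_fract :: complex poly \<Rightarrow> ratfun"
    by unfold_locales simp_all
  define Ai where "Ai = the (mat_inverse (poly_rm A))"
  have Ar: "poly_rm A \<in> carrier_mat n n"
    using A by simp
  have "det (poly_rm A) \<noteq> 0"
    using det by simp
  note Ai = mat_inverse_mult[OF Ar this, folded Ai_def]
  have col: "Ai *\<^sub>v col (poly_rm B) q = y q" if q: "q < k" for q
  proof -
    have "y q = (Ai * poly_rm A) *\<^sub>v y q"
      using y[OF q] by (simp add: Ai(2))
    also have "\<dots> = Ai *\<^sub>v (poly_rm A *\<^sub>v y q)"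
      by (rule assoc_mult_mat_vec[OF Ai(1) Ar y[OF q]])
    finally show ?thesis
      by (simp only: Ay[OF q])
  qed
  have "(poly_rm C * Ai * poly_rm B) $$ (r, q) = (poly_rm C *\<^sub>v y q) $ r"
    if r: "r < l" and q: "q < k" for r q
  proof -
    have "poly_rm C * Ai * poly_rm B = poly_rm C * (Ai * poly_rm B)"
      using B C Ai by (intro assoc_mult_mat[of _ l n _ n _ k]) simp_all
    moreover have "col (Ai * poly_rm B) q = y q"
      using col_mult2[OF Ai(1), of "poly_rm B" k q] B q col[OF q] by simp
    ultimately show ?thesis
      using r q B C Ai by (simp del: col_mult2)
  qed
  then show ?thesis
    unfolding transfer_function_def Ai_def[symmetric]
    using B C D H Ai(1) Cy by (intro eq_matI) auto
qed

text \<open>The upper halves of the columns of \<open>A\<^sup>-\<^sup>1 B\<close> are supported on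
  one residue class modulo \<open>m\<close>, one entry per block; this collapses their products with
  \<open>F^*\<close> to sums over blocks.\<close>

lemma sum_kronecker_delta_block:
  fixes f :: "nat \<Rightarrow> 'a :: comm_monoid_add"
  assumes "q < m"
  shows "(\<Sum>p = 0..<d * m. if p mod m = q then f p else 0) = (\<Sum>i<d. f (i * m + q))"
proof -
  have "(\<Sum>p = 0..<d * m. if p mod m = q then f p else 0) = sum f {p \<in> {0..<d * m}. p mod m = q}"
    by (rule sum.inter_filter[symmetric]) simp
  also have "{p \<in> {0..<d * m}. p mod m = q} = (\<lambda>i. i * m + q) ` {..<d}"
  proof (intro equalityI subsetI)
    fix p assume p: "p \<in> {p \<in> {0..<d * m}. p mod m = q}"
    then have "p = p div m * m + q" "p div m < d"
      by (auto simp: less_mult_imp_div_less)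
    then show "p \<in> (\<lambda>i. i * m + q) ` {..<d}"
      by blast
  next
    fix p assume "p \<in> (\<lambda>i. i * m + q) ` {..<d}"
    then obtain i where i: "i < d" "p = i * m + q" by blast
    have "i * m + q < Suc i * m"
      using assms by simp
    also have "\<dots> \<le> d * m"
      using i by (intro mult_le_mono1) simp
    finally show "p \<in> {p \<in> {0..<d * m}. p mod m = q}"
      using i assms by simp
  qed
  also have "sum f \<dots> = (\<Sum>i<d. f (i * m + q))"
    using assms by (subst sum.reindex) (auto simp: inj_on_def)
  finally show ?thesis .
qed

text \<open>The \<open>q\<close>-th column of \<open>A\<^sup>-\<^sup>1 B\<close> is the vector \<open>x @\<^sub>v y\<close> with \<open>y\<close>
  and \<open>x\<close> as in the next two lemmas.\<close>

lemma shift_mat_solution: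
  fixes c :: "nat \<Rightarrow> nat \<Rightarrow> 'a :: field" and w :: 'a
  assumes w: "w \<noteq> 0" and m: "m > 0"
    and y: "y = vec (d * m) (\<lambda>p. \<Sum>k\<le>p div m. c k (p mod m) / w ^ (Suc (p div m) - k))"
  shows "shift_mat (d * m) m (- w) 1 *\<^sub>v y = - vec (d * m) (\<lambda>p. c (p div m) (p mod m))"
proof (intro eq_vecI)
  fix p assume "p < dim_vec (- vec (d * m) (\<lambda>p. c (p div m) (p mod m)))"
  then have p: "p < d * m" by simp
  define r where "r = p mod m"
  define g where "g i = (\<Sum>k\<le>i. c k r / w ^ (Suc i - k))" for i
  have yc: "y \<in> carrier_vec (d * m)"
    by (simp add: y)
  have g0: "w * g 0 = c 0 r"
    using w by (simp add: g_def)
  \<comment> \<open>One block further down, the old terms are divided by \<open>w\<close> and a new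
    term joins: this is the block row of the system with its sign reversed.\<close>
  have gS: "w * g (Suc i) = g i + c (Suc i) r" for i
  proof -
    have "(\<Sum>k\<le>i. c k r / w ^ (Suc (Suc i) - k)) = (\<Sum>k\<le>i. c k r / w ^ (Suc i - k)) / w"
      unfolding sum_divide_distrib by (intro sum.cong) (auto simp: Suc_diff_le mult.commute)
    then show ?thesis
      using w by (simp add: g_def distrib_left)
  qed
  have yp: "y $ p = g (p div m)"
    using p by (simp add: y g_def r_def)
  have "(shift_mat (d * m) m (- w) 1 *\<^sub>v y) $ p = - (c (p div m) r)"
  proof (cases "m \<le> p")
    case True
    then have "p div m = Suc ((p - m) div m)" "(p - m) mod m = r"
      using m by (simp_all add: le_div_geq r_def le_mod_geq)
    moreover have "y $ (p - m) = g ((p - m) div m)"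
      using p True calculation(2) by (simp add: y g_def)
    ultimately show ?thesis
      using shift_mat_mult_vec[OF yc p m, of "- w" 1] True by (simp add: yp gS)
  next
    case False
    then show ?thesis
      using shift_mat_mult_vec[OF yc p m, of "- w" 1] by (simp add: yp g0)
  qed
  then show "(shift_mat (d * m) m (- w) 1 *\<^sub>v y) $ p = (- vec (d * m) (\<lambda>p. c (p div m) (p mod m))) $ p"
    using p by (simp add: r_def)
qed simp

lemma shift_mat_transpose_solution:
  fixes w z e :: "'a :: field"
  assumes w: "w \<noteq> 0" and q: "q < m"
    and x: "x = vec (d * m) (\<lambda>p. if p mod m = q then e * z ^ (d - Suc (p div m)) / w ^ (d - p div m) else 0)"
  shows "(shift_mat (d * m) m (- w) z)\<^sup>T *\<^sub>v x = - (e \<cdot>\<^sub>v row (last_block (d * m) m) q)"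
proof (intro eq_vecI)
  fix p assume "p < dim_vec (- (e \<cdot>\<^sub>v row (last_block (d * m) m :: 'a mat) q))"
  then have p: "p < d * m" by simp
  have m: "m > 0" using q by simp
  have xc: "x \<in> carrier_vec (d * m)"
    by (simp add: x)
  define i where "i = p div m"
  have i: "i < d"
    using p by (simp add: i_def less_mult_imp_div_less)
  have pi: "p = i * m + p mod m"
    by (simp add: i_def)
  have pm: "p mod m < m" using m by simp
  have rhs: "(- (e \<cdot>\<^sub>v row (last_block (d * m) m) q)) $ p = - (if p = d * m - m + q then e else 0)"
    using p q by (simp add: last_block_def)
  have "((shift_mat (d * m) m (- w) z)\<^sup>T *\<^sub>v x) $ p = - (if p = d * m - m + q then e else 0)"
  proof (cases "Suc i < d")
    case True
    have "(i + 2) * m \<le> d * m"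
      using True by (intro mult_le_mono1) simp
    then have lt: "p + m < d * m" and ne: "p \<noteq> d * m - m + q"
      using pi pm by (simp_all add: algebra_simps)
    have "x $ (p + m) = (if p mod m = q then e * z ^ (d - Suc (Suc i)) / w ^ (d - Suc i) else 0)"
      using lt m by (simp add: x i_def)
    moreover have "x $ p = (if p mod m = q then e * z ^ (d - Suc i) / w ^ (d - i) else 0)"
      using p by (simp add: x i_def)
    \<comment> \<open>Moving one block up multiplies the entry by \<open>z / w\<close>; successor
      form exposes this factor in both powers.\<close>
    moreover have "d - i = Suc (d - Suc i)" "d - Suc i = Suc (d - Suc (Suc i))"
      using True by simp_all
    ultimately show ?thesis
      using shift_mat_transpose_mult_vec[OF xc p m, of "- w" z] lt ne w by simp
  next
    case False
    then have d: "d = Suc i" using i by simp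
    then have nlt: "\<not> p + m < d * m" and eq: "p = d * m - m + q \<longleftrightarrow> p mod m = q"
      using pi by (simp_all) (metis add_left_cancel)
    have "x $ p = (if p mod m = q then e / w else 0)"
      using p by (simp add: x i_def[symmetric] d)
    then show ?thesis
      using shift_mat_transpose_mult_vec[OF xc p m, of "- w" z] nlt eq w by simp
  qed
  then show "((shift_mat (d * m) m (- w) z)\<^sup>T *\<^sub>v x) $ p = (- (e \<cdot>\<^sub>v row (last_block (d * m) m) q)) $ p"
    using rhs by simp
qed simp

section \<open>Entries of \<open>R_lam(z)\<close> and of \<open>R_lam^*(1/z)\<close>\<close>

lemma cnj_rf_divide: "cnj_rf (x / y) = cnj_rf x / cnj_rf y"
  by (simp add: divide_inverse cnj_rf.hom_mult cnj_rf.hom_inverse)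

lemma recip_rf_divide: "recip_rf (x / y) = recip_rf x / recip_rf y"
  by (simp add: divide_inverse recip_rf.hom_mult recip_rf.hom_inverse)

text \<open>The summation index \<open>k = d - j\<close> follows the block order of
  \<open>F\<close>.\<close>

lemma R_lam_index:
  assumes "r < m" "q < m"
  shows "R_lam d m lam Rs $$ (r, q) =
    (\<Sum>k<d. const_rf (Rs (d - k) $$ (r, q)) / (zvar - const_rf lam) ^ (d - k))"
proof -
  have "(\<Sum>k<d. const_rf (Rs (d - k) $$ (r, q)) / (zvar - const_rf lam) ^ (d - k)) =
    (\<Sum>j = 1..d. const_rf (Rs j $$ (r, q)) / (zvar - const_rf lam) ^ j)"
    by (rule sum.reindex_bij_witness[of _ "\<lambda>j. d - j" "\<lambda>k. d - k"]) auto
  then show ?thesis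
    using assms by (simp add: R_lam_def)
qed

lemma R_lam_dim [simp]: "dim_row (R_lam d m lam Rs) = m" "dim_col (R_lam d m lam Rs) = m"
  by (simp_all add: R_lam_def)

text \<open>Inserting \<open>1/z\<close> into \<open>1 / (z - cnj lam)\<close> gives
  \<open>z / (1 - cnj lam z)\<close>; transposition swaps the indices of the coefficients.\<close>

lemma rm_recip_rm_star_R_lam_index:
  assumes "r < m" "q < m"
  shows "rm_recip (rm_star (R_lam d m lam Rs)) $$ (r, q) =
    (\<Sum>k<d. const_rf (cnj (Rs (d - k) $$ (q, r))) * zvar ^ (d - k)
      / (1 - const_rf (cnj lam) * zvar) ^ (d - k))"
proof -
  have "1 / zvar - const_rf (cnj lam) = (1 - const_rf (cnj lam) * zvar) / zvar"
    by (simp add: diff_divide_distrib)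
  then have "rm_recip (rm_star (R_lam d m lam Rs)) $$ (r, q) =
    (\<Sum>k<d. const_rf (cnj (Rs (d - k) $$ (q, r)))
      / ((1 - const_rf (cnj lam) * zvar) / zvar) ^ (d - k))"
    using assms
    by (simp add: rm_recip_def rm_star_def R_lam_index[OF assms(2,1)]
        cnj_rf.hom_sum recip_rf.hom_sum cnj_rf_divide recip_rf_divide cnj_rf.hom_power
        recip_rf.hom_power cnj_rf.hom_minus recip_rf.hom_minus)
  then show ?thesis
    by (simp add: power_divide)
qed

lemma const_rf_minus_1: "const_rf (-1) = -1"
proof -
  have "[:-1:] = - (1 :: complex poly)"
    by (simp add: one_pCons)
  then show ?thesis
    by (metis to_fract_1 to_fract_uminus)
qed

lemma transfer_function_lam:
  assumes d: "d \<ge> 1" and Rs: "\<And>j. j \<le> d \<Longrightarrow> Rs j \<in> carrier_mat m m"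
  shows "transfer_function (A_lam d m lam) (B_lam d m Rs) (C_lam d m Rs) (D_lam Rs) =
    (1 + zvar) \<cdot>\<^sub>m (R_lam d m lam Rs + const_rm (Rs 0) + rm_recip (rm_star (R_lam d m lam Rs)))"
proof -
  define n where "n = d * m"
  define e where "e = 1 + zvar"
  \<comment> \<open>\<open>w\<close> and \<open>w'\<close> are the denominators of the two parts of
    \<open>R\<close>, hence the negatives of the diagonal entries of \<open>K\<close> and of its
    reversed adjoint.\<close>
  define w where "w = zvar - const_rf lam"
  define w' where "w' = 1 - const_rf (cnj lam) * zvar"
  define x where "x q = vec n (\<lambda>p. if p mod m = q
    then e * zvar ^ (d - Suc (p div m)) / w' ^ (d - p div m) else 0)" for q
  define y where "y q = vec n (\<lambda>p. \<Sum>k\<le>p div m.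
    const_rf (Rs (d - k) $$ (p mod m, q)) / w ^ (Suc (p div m) - k))" for q
  have w: "to_fract [:lam, -1:] = - w" "to_fract [:-1, cnj lam:] = - w'"
    using to_fract_linear[of lam "-1"] to_fract_linear[of "-1" "cnj lam"]
    by (simp_all add: w_def w'_def const_rf_minus_1)
  have "to_fract [:lam, -1:] \<noteq> 0" "to_fract [:-1, cnj lam:] \<noteq> 0"
    by simp_all
  then have nz: "w \<noteq> 0" "w' \<noteq> 0"
    unfolding w by simp_all
  have R0: "Rs 0 \<in> carrier_mat m m"
    using Rs by simp
  have car: "x q \<in> carrier_vec n" "y q \<in> carrier_vec n" for q
    by (simp_all add: x_def y_def)
  have Fp: "F_mat d m Rs $$ (p, q) = Rs (d - p div m) $$ (p mod m, q)" if "p < n" "q < m" for p q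
    using that by (simp add: index_F_mat n_def)
  show ?thesis
  proof (rule transfer_functionI[OF A_lam_carrier det_A_lam B_lam_carrier C_lam_carrier,
        where y = "\<lambda>q. x q @\<^sub>v y q"])
    show "D_lam Rs \<in> carrier_mat m m"
      using R0 by (simp add: D_lam_def)
    show "(1 + zvar) \<cdot>\<^sub>m (R_lam d m lam Rs + const_rm (Rs 0) + rm_recip (rm_star (R_lam d m lam Rs)))
        \<in> carrier_mat m m"
      by (auto simp: rm_recip_def rm_star_def)
    show "x q @\<^sub>v y q \<in> carrier_vec (d * m + d * m)" for q
      using car[of q] by (simp add: n_def)
    show "poly_rm (A_lam d m lam) *\<^sub>v (x q @\<^sub>v y q) = col (poly_rm (B_lam d m Rs)) q"
      if q: "q < m" for q
    proof -
      have "m > 0" using q by simp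
      have "shift_mat n m (- w) 1 *\<^sub>v y q =
          - vec n (\<lambda>p. const_rf (Rs (d - p div m) $$ (p mod m, q)))"
        unfolding n_def
        by (rule shift_mat_solution[where c = "\<lambda>k r. const_rf (Rs (d - k) $$ (r, q))"])
          (use nz \<open>m > 0\<close> in \<open>simp_all add: y_def n_def\<close>)
      moreover have "(shift_mat n m (- w') zvar)\<^sup>T *\<^sub>v x q = - (e \<cdot>\<^sub>v row (last_block n m) q)"
        unfolding n_def by (rule shift_mat_transpose_solution) (use nz q in \<open>simp_all add: x_def n_def\<close>)
      ultimately have "poly_rm (A_lam d m lam) *\<^sub>v (x q @\<^sub>v y q) =
          - (- vec n (\<lambda>p. const_rf (Rs (d - p div m) $$ (p mod m, q))) @\<^sub>v
             - (e \<cdot>\<^sub>v row (last_block n m) q))"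
        using car by (simp add: poly_rm_A_lam_mult_vec n_def w)
      also have "\<dots> = col (poly_rm (B_lam d m Rs)) q"
        using q by (intro eq_vecI)
          (auto simp: B_lam_def append_rows_def n_def[symmetric] Fp e_def last_block_def
            to_fract_one_plus_z)
      finally show ?thesis .
    qed
    show "((1 + zvar) \<cdot>\<^sub>m (R_lam d m lam Rs + const_rm (Rs 0) + rm_recip (rm_star (R_lam d m lam Rs)))) $$ (r, q)
        = to_fract (D_lam Rs $$ (r, q)) + (poly_rm (C_lam d m Rs) *\<^sub>v (x q @\<^sub>v y q)) $ r"
      if r: "r < m" and q: "q < m" for r q
    proof -
      have "m > 0" "m \<le> n" using q d by (simp_all add: n_def)
      have C: "poly_rm (C_lam d m Rs) =
          (zvar \<cdot>\<^sub>m const_rm (mat_adjoint (F_mat d m Rs))) @\<^sub>c (e \<cdot>\<^sub>m last_block n m)"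
        by (intro eq_matI)
          (auto simp: C_lam_def append_cols_def to_fract_one_plus_z e_def n_def last_block_def
            zvar_mult_const_rf)
      \<comment> \<open>Here the factor \<open>1 + z\<close> was already contributed by
        \<open>B\<close> through \<open>x\<close>, and the \<open>z\<close> in front of
        \<open>F^*\<close> supplies the power missing in \<open>x\<close>.\<close>
      have F: "((zvar \<cdot>\<^sub>m const_rm (mat_adjoint (F_mat d m Rs))) *\<^sub>v x q) $ r =
          e * rm_recip (rm_star (R_lam d m lam Rs)) $$ (r, q)"
      proof -
        have "((zvar \<cdot>\<^sub>m const_rm (mat_adjoint (F_mat d m Rs))) *\<^sub>v x q) $ r =
          (\<Sum>p = 0..<d * m. if p mod m = q then zvar * const_rf (cnj (Rs (d - p div m) $$ (p mod m, r)))
            * (e * zvar ^ (d - Suc (p div m)) / w' ^ (d - p div m)) else 0)"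
          using r by (auto simp: scalar_prod_def x_def Fp n_def[symmetric] intro!: sum.cong)
        also have "\<dots> = (\<Sum>i<d. zvar * const_rf (cnj (Rs (d - i) $$ (q, r)))
            * (e * zvar ^ (d - Suc i) / w' ^ (d - i)))"
          using q by (subst sum_kronecker_delta_block) auto
        also have "\<dots> = (\<Sum>i<d. e * (const_rf (cnj (Rs (d - i) $$ (q, r))) * zvar ^ (d - i) / w' ^ (d - i)))"
        proof (intro sum.cong refl)
          fix i assume "i \<in> {..<d}"
          then have "zvar ^ (d - i) = zvar * zvar ^ (d - Suc i)"
            by (simp add: Suc_diff_Suc flip: power_Suc)
          then show "zvar * const_rf (cnj (Rs (d - i) $$ (q, r))) * (e * zvar ^ (d - Suc i) / w' ^ (d - i)) =
              e * (const_rf (cnj (Rs (d - i) $$ (q, r))) * zvar ^ (d - i) / w' ^ (d - i))"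
            by (simp only: times_divide_eq_right mult_ac)
        qed
        also have "\<dots> = e * rm_recip (rm_star (R_lam d m lam Rs)) $$ (r, q)"
          unfolding rm_recip_rm_star_R_lam_index[OF r q] w'_def sum_distrib_left ..
        finally show ?thesis .
      qed
      \<comment> \<open>Here \<open>C\<close> contributes the factor \<open>1 + z\<close>, and the
        last block of the forward substitution is the full sum \<open>R_lam\<close>.\<close>
      have E: "((e \<cdot>\<^sub>m last_block n m) *\<^sub>v y q) $ r = e * R_lam d m lam Rs $$ (r, q)"
      proof -
        have idx: "n - m + r = (d - 1) * m + r"
          by (simp add: n_def diff_mult_distrib)
        have "((e \<cdot>\<^sub>m last_block n m) *\<^sub>v y q) $ r = e * y q $ (n - m + r)"
          using r last_block_mult_vec[OF car(2) r \<open>m \<le> n\<close>, of q]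
          by (subst smult_mat_mult_vec[OF last_block_carrier car(2)]) simp
        also have "y q $ (n - m + r) = (\<Sum>k\<le>d - 1. const_rf (Rs (d - k) $$ (r, q)) / w ^ (Suc (d - 1) - k))"
        proof -
          have "n - m + r < n"
            using r \<open>m \<le> n\<close> by simp
          moreover have "(n - m + r) div m = d - 1" "(n - m + r) mod m = r"
            unfolding idx using r by simp_all
          ultimately show ?thesis by (simp add: y_def)
        qed
        also have "\<dots> = R_lam d m lam Rs $$ (r, q)"
          unfolding R_lam_index[OF r q] w_def using d by (intro sum.cong) auto
        finally show ?thesis .
      qed
      have "(poly_rm (C_lam d m Rs) *\<^sub>v (x q @\<^sub>v y q)) $ r =
          e * rm_recip (rm_star (R_lam d m lam Rs)) $$ (r, q) + e * R_lam d m lam Rs $$ (r, q)"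
      proof -
        have "zvar \<cdot>\<^sub>m const_rm (mat_adjoint (F_mat d m Rs)) \<in> carrier_mat m n"
          by (auto simp: n_def intro!: carrier_matI)
        then show ?thesis
          unfolding C using r F E car by (subst append_cols_mult_vec[of _ m n _ n]) auto
      qed
      then show ?thesis
        using r q R0
        by (simp add: D_lam_def to_fract_one_plus_z e_def rm_recip_def rm_star_def distrib_left
            add_ac)
    qed
  qed
qed

theorem theorem6p3:
  fixes lam :: complex and d m :: nat and R :: ratmat and Rs :: "nat \<Rightarrow> complex mat"
  assumes "cmod lam < 1" and "d \<ge> 1"
    and "R \<in> carrier_mat m m" and "para_Hermitian R"
    and "\<And>j. j \<le> d \<Longrightarrow> Rs j \<in> carrier_mat m m"
    and "mat_adjoint (Rs 0) = Rs 0"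
    and "invertible_mat (Rs d)"
    and "R = R_lam d m lam Rs + const_rm (Rs 0) + rm_recip (rm_star (R_lam d m lam Rs))"
  shows "star_palindromic (L_lam d m lam Rs) \<and>
    strongly_minimal_linearization (2 * d * m) (L_lam d m lam Rs) ((1 + zvar) \<cdot>\<^sub>m R)"
proof
  have R0: "Rs 0 \<in> carrier_mat m m" and Rd: "Rs d \<in> carrier_mat m m"
    using assms(5) by simp_all
  show "star_palindromic (L_lam d m lam Rs)"
    using star_palindromic_L_lam[of d Rs m, OF assms(2) R0 assms(6)] .
  have "is_linear_system (A_lam d m lam) (B_lam d m Rs) (C_lam d m Rs) (D_lam Rs)"
    using R0 B_lam_carrier[of d m Rs] C_lam_carrier[of d m Rs] pencil_D_lam[of Rs]
    by (auto simp: is_linear_system_def pencil_A_lam pencil_B_lam pencil_C_lam det_A_lam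
        D_lam_def simp del: B_lam_carrier C_lam_carrier)
  moreover have "dim_row (A_lam d m lam) = 2 * d * m"
    by simp
  ultimately show "strongly_minimal_linearization (2 * d * m) (L_lam d m lam Rs) ((1 + zvar) \<cdot>\<^sub>m R)"
    unfolding strongly_minimal_linearization_def
    using L_lam_eq[of d Rs m lam, OF assms(2) R0] minimal_system_lam[of lam d Rs m, OF assms(1,2) Rd assms(7)]
      minimal_at_infinity_lam[of lam d Rs m, OF assms(1,2) Rd assms(7)]
      transfer_function_lam[of d Rs m lam, OF assms(2) assms(5), folded assms(8)]
    by blast
qed

end
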